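(* Let $\alpha>0$, $\omega\in\mathbb{R}$, and $c\in\mathbb{C}$. The pair $\{\alpha e^{i\omega t}, ce^{i\omega t}\}$ is eventually admissible for the defocusing NLS equation $iu_t+u_{xx}-2|u|^2u=0$ if and only if $(\alpha,\omega,c)$ belongs to the set $$\big\{(\alpha,\omega,c=-\alpha\sqrt{\omega+\alpha^2})\ \big|\ \omega>0,\ \alpha>0\big\}.$$ Moreover, if $(\alpha,\omega,c)$ belongs to this set, then there is a unique solution $u(x,t)$ of the defocusing NLS in the quarter plane which satisfies $$u(0,t)=\alpha e^{i\omega t},\qquad u_x(0,t)=ce^{i\omega t},\qquad t\ge0.$$ This solution is given explicitly by $$u(x,t)=\frac{2\alpha\sqrt{\omega}\,\big(\sqrt{\alpha^2+\omega}+\sqrt{\omega}\big)e^{x\sqrt{\omega}+it\omega}}{\alpha^2\big(e^{2x\sqrt{\omega}}-1\big)+2\sqrt{\omega}\,\big(\sqrt{\alpha^2+\omega}+\sqrt{\omega}\big)e^{2x\sqrt{\omega}}},\qquad x\ge0,\ t\ge0.$$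
   Context: The defocusing nonlinear Schrödinger (NLS) equation is $iu_t+u_{xx}-2|u|^2u=0$. A *solution of the NLS in the quarter plane* is a smooth function $u:[0,\infty)\times[0,\infty)\to\mathbb{C}$, $(x,t)\mapsto u(x,t)$, such that (i) $u(\cdot,t)$ belongs to the Schwartz class $\mathcal{S}([0,\infty))$ of rapidly decreasing functions for each $t\in[0,\infty)$; (ii) $u$ satisfies the NLS equation for $x>0$ and $t>0$; (iii) $\|u(\cdot,t)\|_{L^1([0,\infty))}$ grows at most linearly in $t$ as $t\to\infty$. A pair of smooth functions $\{g_0^b(t),g_1^b(t)\}$, $t\ge0$, is *eventually admissible* for NLS if there exist a solution $u$ of the NLS in the quarter plane and a $t_0>0$ such that $u(0,t)=g_0^b(t)$ and $u_x(0,t)=g_1^b(t)$ for all $t\ge t_0$. *)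

theory Defs
  imports "HOL-Analysis.Analysis" "HOL-Library.Landau_Symbols"
begin

text \<open>
  Functions on \<open>[0,\<infinity>)\<close> and on the quarter plane \<open>[0,\<infinity>) \<times> [0,\<infinity>)\<close> are total HOL functions.
  All derivatives are taken within \<open>[0,\<infinity>)\<close>, i.e. they are one-sided at the boundary and
  ordinary ones in the interior, so nothing below depends on values outside the closed
  domain.
\<close>

definition deriv_half :: "(real \<Rightarrow> complex) \<Rightarrow> real \<Rightarrow> complex" where
  "deriv_half f x = vector_derivative f (at x within {0..})"

definition smooth_half :: "(real \<Rightarrow> complex) \<Rightarrow> bool" where
  "smooth_half f \<longleftrightarrow> (\<forall>k. \<forall>x\<ge>0. (deriv_half ^^ k) f differentiable (at x within {0..}))"

definition schwartz_half :: "(real \<Rightarrow> complex) \<Rightarrow> bool" where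
  "schwartz_half f \<longleftrightarrow> smooth_half f \<and>
     (\<forall>j k. bounded ((\<lambda>x. of_real (x ^ j) * (deriv_half ^^ k) f x) ` {0..}))"

definition pdx :: "(real \<Rightarrow> real \<Rightarrow> complex) \<Rightarrow> real \<Rightarrow> real \<Rightarrow> complex" where
  "pdx u x t = deriv_half (\<lambda>y. u y t) x"

definition pdt :: "(real \<Rightarrow> real \<Rightarrow> complex) \<Rightarrow> real \<Rightarrow> real \<Rightarrow> complex" where
  "pdt u x t = deriv_half (\<lambda>s. u x s) t"

text \<open>Class \<open>C\<^sup>n\<close> on the closed quarter plane, including the boundary.\<close>

primrec Cn_quarter :: "nat \<Rightarrow> (real \<Rightarrow> real \<Rightarrow> complex) \<Rightarrow> bool" where
  "Cn_quarter 0 u \<longleftrightarrow> continuous_on ({0..} \<times> {0..}) (\<lambda>(x, t). u x t)"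
| "Cn_quarter (Suc n) u \<longleftrightarrow>
     (\<forall>x\<ge>0. \<forall>t\<ge>0. (\<lambda>y. u y t) differentiable (at x within {0..}) \<and>
                   (\<lambda>s. u x s) differentiable (at t within {0..})) \<and>
     Cn_quarter n (pdx u) \<and> Cn_quarter n (pdt u)"

definition smooth_quarter :: "(real \<Rightarrow> real \<Rightarrow> complex) \<Rightarrow> bool" where
  "smooth_quarter u \<longleftrightarrow> (\<forall>n. Cn_quarter n u)"

text \<open>
  The Schwartz condition makes the integrand in the last clause integrable, so the
  Lebesgue integral there is the genuine \<open>L\<^sup>1\<close> norm.
\<close>

definition nls_quarter_solution :: "(real \<Rightarrow> real \<Rightarrow> complex) \<Rightarrow> bool" where
  "nls_quarter_solution u \<longleftrightarrow>
     smooth_quarter u \<and>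
     (\<forall>t\<ge>0. schwartz_half (\<lambda>x. u x t)) \<and>
     (\<forall>x>0. \<forall>t>0. \<i> * pdt u x t + pdx (pdx u) x t
                     - 2 * of_real ((norm (u x t))\<^sup>2) * u x t = 0) \<and>
     (\<lambda>t. LINT x:{0..}|lborel. norm (u x t)) \<in> O[at_top](\<lambda>t::real. t)"

definition eventually_admissible :: "(real \<Rightarrow> complex) \<Rightarrow> (real \<Rightarrow> complex) \<Rightarrow> bool" where
  "eventually_admissible g0 g1 \<longleftrightarrow>
     smooth_half g0 \<and> smooth_half g1 \<and>
     (\<exists>u t0. nls_quarter_solution u \<and> t0 > 0 \<and>
        (\<forall>t\<ge>t0. u 0 t = g0 t \<and> pdx u 0 t = g1 t))"

definition admissible_triples :: "(real \<times> real \<times> complex) set" where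
  "admissible_triples =
     {(\<alpha>, \<omega>, complex_of_real (- \<alpha> * sqrt (\<omega> + \<alpha>\<^sup>2))) | \<alpha> \<omega>. \<omega> > 0 \<and> \<alpha> > 0}"

definition explicit_solution :: "real \<Rightarrow> real \<Rightarrow> real \<Rightarrow> real \<Rightarrow> complex" where
  "explicit_solution \<alpha> \<omega> x t =
     of_real (2 * \<alpha> * sqrt \<omega> * (sqrt (\<alpha>\<^sup>2 + \<omega>) + sqrt \<omega>)) *
       exp (of_real (x * sqrt \<omega>) + \<i> * of_real (t * \<omega>)) /
     of_real (\<alpha>\<^sup>2 * (exp (2 * x * sqrt \<omega>) - 1) +
              2 * sqrt \<omega> * (sqrt (\<alpha>\<^sup>2 + \<omega>) + sqrt \<omega>) * exp (2 * x * sqrt \<omega>))"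

end

theory Submission
  imports Defs
begin

text \<open>
  The line \<open>x = 0\<close> is noncharacteristic for the Schroedinger operator, so the Cauchy data
  \<open>u(0, t)\<close>, \<open>u\<^sub>x(0, t)\<close> for \<open>t \<ge> t\<^sub>0\<close> determine \<open>u(x, t)\<close> for all \<open>x \<ge> 0\<close>, \<open>t > t\<^sub>0\<close>. This is a
  Carleman estimate: with \<open>\<phi> = (x - R)\<^sup>2 - B (t - t\<^sub>1)\<^sup>2\<close> and \<open>z = e\<^sup>\<tau>\<^sup>\<phi> w\<close>, where \<open>w\<close> is the difference of
  two solutions, the commutator of the self-adjoint and skew-adjoint parts of the conjugated
  operator is of size \<open>\<tau>\<^sup>3\<close>. No decay of \<open>u\<close> in \<open>x\<close> is used, hence no uniformity in \<open>t\<close> either.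

  Given exponential data, \<open>e\<^sup>-\<^sup>i\<^sup>\<omega>\<^sup>h u(x, t + h)\<close> has the same data as \<open>u\<close>; therefore
  \<open>u(x, t) = e\<^sup>i\<^sup>\<omega>\<^sup>t U(x)\<close> with \<open>U'' = \<omega> U + 2 |U|\<^sup>2 U\<close>. Since \<open>U\<close> decays, its first integrals
  \<open>|U'|\<^sup>2 - \<omega> |U|\<^sup>2 - |U|\<^sup>4\<close> and \<open>Im (U' U\<^sup>*)\<close> vanish. For \<open>\<omega> < 0\<close> the first forces
  \<open>|U|\<^sup>2 \<ge> - \<omega>\<close> wherever \<open>U \<noteq> 0\<close>, for \<open>\<omega> = 0\<close> it allows only algebraic decay, and for \<open>\<omega> \<ge> 0\<close> the
  function \<open>|U|\<^sup>2\<close> is convex, hence decreasing, which fixes the sign of \<open>c\<close>.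
\<close>

section \<open>A Carleman estimate\<close>

text \<open>
  Conjugating \<open>i \<partial>\<^sub>t + \<partial>\<^sub>x\<^sup>2\<close> by \<open>e\<^sup>\<tau>\<^sup>\<phi>\<close> with \<open>\<phi>\<^sub>x\<^sub>x = 2\<close>, \<open>\<phi>\<^sub>x\<^sub>t = 0\<close> gives \<open>S + A\<close>, where
  \<open>S = i \<partial>\<^sub>t + \<partial>\<^sub>x\<^sup>2 + p\<^sup>2\<close>, \<open>A = - 2 p \<partial>\<^sub>x - 2 \<tau> - i g\<close>, \<open>p = \<tau> \<phi>\<^sub>x\<close> and \<open>g = \<tau> \<phi>\<^sub>t\<close>. The two
  fluxes are the boundary terms from integrating \<open>2 Re (S z (A z)\<^sup>*)\<close> by parts; \<open>\<kappa> = - \<tau> \<phi>\<^sub>t\<^sub>t\<close>.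
\<close>

definition carleman_flux_x :: "real \<Rightarrow> real \<Rightarrow> real \<Rightarrow> complex \<Rightarrow> complex \<Rightarrow> complex \<Rightarrow> real" where
  "carleman_flux_x \<tau> p g z zx zt =
     - 2 * p * Im (z * cnj zt) - 2 * p * (cmod zx)\<^sup>2 - 4 * \<tau> * Re (zx * cnj z)
     - 2 * g * Im (zx * cnj z) - 2 * p ^ 3 * (cmod z)\<^sup>2"

definition carleman_flux_t :: "real \<Rightarrow> real \<Rightarrow> complex \<Rightarrow> complex \<Rightarrow> real" where
  "carleman_flux_t p g z zx = 2 * p * Im (z * cnj zx) - g * (cmod z)\<^sup>2"

definition carleman_flux_x_deriv ::
    "real \<Rightarrow> real \<Rightarrow> real \<Rightarrow> complex \<Rightarrow> complex \<Rightarrow> complex \<Rightarrow> complex \<Rightarrow> complex \<Rightarrow> real" where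
  "carleman_flux_x_deriv \<tau> p g z zx zt zxx zxt =
     - 4 * \<tau> * Im (z * cnj zt) - 2 * p * (Im (zx * cnj zt) + Im (z * cnj zxt))
     - 8 * \<tau> * (cmod zx)\<^sup>2 - 4 * p * Re (zxx * cnj zx) - 4 * \<tau> * Re (zxx * cnj z)
     - 2 * g * Im (zxx * cnj z) - 12 * \<tau> * p\<^sup>2 * (cmod z)\<^sup>2 - 4 * p ^ 3 * Re (z * cnj zx)"

definition carleman_flux_t_deriv ::
    "real \<Rightarrow> real \<Rightarrow> real \<Rightarrow> complex \<Rightarrow> complex \<Rightarrow> complex \<Rightarrow> complex \<Rightarrow> real" where
  "carleman_flux_t_deriv \<kappa> p g z zx zt zxt =
     2 * p * (Im (zt * cnj zx) + Im (z * cnj zxt)) + \<kappa> * (cmod z)\<^sup>2 - 2 * g * Re (z * cnj zt)"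

section \<open>Flux derivatives and the pointwise commutator inequality\<close>

lemma has_real_derivative_Re_Im:
  assumes "(z has_vector_derivative z') (at x within S)"
  shows "((\<lambda>x. Re (z x)) has_real_derivative Re z') (at x within S)"
    and "((\<lambda>x. Im (z x)) has_real_derivative Im z') (at x within S)"
  using bounded_linear.has_vector_derivative[OF bounded_linear_Re assms]
    bounded_linear.has_vector_derivative[OF bounded_linear_Im assms]
  by (simp_all add: has_real_derivative_iff_has_vector_derivative)

lemma carleman_flux_x_has_derivative:
  assumes "(z has_vector_derivative zx x) (at x within S)"
    and "(zx has_vector_derivative zxx) (at x within S)"
    and "(zt has_vector_derivative zxt) (at x within S)"
    and "(p has_real_derivative 2 * \<tau>) (at x within S)"
  shows "((\<lambda>x. carleman_flux_x \<tau> (p x) g (z x) (zx x) (zt x)) has_real_derivative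
            carleman_flux_x_deriv \<tau> (p x) g (z x) (zx x) (zt x) zxx zxt) (at x within S)"
proof -
  note d = has_real_derivative_Re_Im[OF assms(1)] has_real_derivative_Re_Im[OF assms(2)]
    has_real_derivative_Re_Im[OF assms(3)] assms(4)
  show ?thesis
    unfolding carleman_flux_x_def carleman_flux_x_deriv_def cmod_power2 times_complex.sel cnj.sel
    by (rule d derivative_eq_intros refl)+
       (simp add: algebra_simps power2_eq_square power3_eq_cube)
qed

lemma carleman_flux_t_has_derivative:
  assumes "(z has_vector_derivative zt) (at t within S)"
    and "(zx has_vector_derivative zxt) (at t within S)"
    and "(g has_real_derivative - \<kappa>) (at t within S)"
  shows "((\<lambda>t. carleman_flux_t p (g t) (z t) (zx t)) has_real_derivative
            carleman_flux_t_deriv \<kappa> p (g t) (z t) (zx t) zt zxt) (at t within S)"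
proof -
  note d = has_real_derivative_Re_Im[OF assms(1)] has_real_derivative_Re_Im[OF assms(2)] assms(3)
  show ?thesis
    unfolding carleman_flux_t_def carleman_flux_t_deriv_def cmod_power2 times_complex.sel cnj.sel
    by (rule d derivative_eq_intros refl)+
       (simp add: algebra_simps power2_eq_square power3_eq_cube)
qed

text \<open>All letters are independent numbers here, so this is a polynomial identity in real and
  imaginary parts. The \<open>zxt\<close> terms of the two flux derivatives cancel. The two square
  terms left over are the commutator of \<open>S\<close> and \<open>A\<close>; everything else is a
  divergence.\<close>

lemma carleman_identity:
  fixes z zx zt zxx zxt :: complex and p g \<tau> \<kappa> :: real
  defines "S \<equiv> \<i> * zt + zxx + of_real (p\<^sup>2) * z"
    and "A \<equiv> - (of_real (2 * p) * zx + of_real (2 * \<tau>) * z + \<i> * of_real g * z)"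
  shows "2 * Re (S * cnj A) =
     carleman_flux_x_deriv \<tau> p g z zx zt zxx zxt + carleman_flux_t_deriv \<kappa> p g z zx zt zxt
     + 8 * \<tau> * (cmod zx)\<^sup>2 + (8 * \<tau> * p\<^sup>2 - \<kappa>) * (cmod z)\<^sup>2"
  unfolding S_def A_def carleman_flux_x_deriv_def carleman_flux_t_deriv_def cmod_power2
    times_complex.sel plus_complex.sel uminus_complex.sel cnj.sel Re_complex_of_real
    Im_complex_of_real imaginary_unit.sel
  by algebra

lemma carleman_pointwise:
  fixes z zx zt zxx zxt :: complex and p g \<tau> \<kappa> :: real
  assumes "\<tau> \<ge> 0"
  shows "(8 * \<tau> * p\<^sup>2 - \<kappa>) * (cmod z)\<^sup>2 + carleman_flux_x_deriv \<tau> p g z zx zt zxx zxt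
           + carleman_flux_t_deriv \<kappa> p g z zx zt zxt
         \<le> (cmod (\<i> * zt + zxx + of_real (p\<^sup>2) * z
               - (of_real (2 * p) * zx + of_real (2 * \<tau>) * z + \<i> * of_real g * z)))\<^sup>2"
proof -
  have "2 * Re (S * cnj A) \<le> (cmod (S + A))\<^sup>2" for S A :: complex
  proof -
    have "(cmod (S + A))\<^sup>2 = 2 * Re (S * cnj A) + (cmod S)\<^sup>2 + (cmod A)\<^sup>2"
      unfolding cmod_power2 by (simp add: algebra_simps power2_eq_square)
    then show ?thesis by simp
  qed
  note ineq = this[of "\<i> * zt + zxx + of_real (p\<^sup>2) * z"
      "- (of_real (2 * p) * zx + of_real (2 * \<tau>) * z + \<i> * of_real g * z)"]
  have "0 \<le> 8 * \<tau> * (cmod zx)\<^sup>2"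
    using assms by simp
  then show ?thesis
    using ineq[unfolded carleman_identity[of zt zxx p z zx \<tau> g zxt \<kappa>] add_uminus_conv_diff]
    by linarith
qed

section \<open>Integration over a rectangle and size of the boundary fluxes\<close>

lemma continuous_on_case_prodD:
  assumes "continuous_on S (\<lambda>(x, t). f x t :: complex)"
  shows "continuous_on S (\<lambda>q. f (fst q) (snd q))"
  using assms by (simp add: case_prod_unfold)

text \<open>Green's theorem: each summand is integrated first in the variable in which it is a
  derivative, and continuity permits either order of integration.\<close>

lemma integral_divergence_rectangle:
  fixes X T Xx Tt :: "real \<Rightarrow> real \<Rightarrow> real"
  assumes "a \<le> b" "c \<le> d"
    and X: "\<And>x t. x \<in> {a..b} \<Longrightarrow> t \<in> {c..d} \<Longrightarrow>
              ((\<lambda>x. X x t) has_real_derivative Xx x t) (at x within {a..b})"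
    and T: "\<And>x t. x \<in> {a..b} \<Longrightarrow> t \<in> {c..d} \<Longrightarrow>
              ((\<lambda>t. T x t) has_real_derivative Tt x t) (at t within {c..d})"
    and Xc: "continuous_on ({a..b} \<times> {c..d}) (\<lambda>(x, t). Xx x t)"
    and Tc: "continuous_on ({a..b} \<times> {c..d}) (\<lambda>(x, t). Tt x t)"
  shows "integral ({a..b} \<times> {c..d}) (\<lambda>(x, t). Xx x t + Tt x t) =
           integral {c..d} (\<lambda>t. X b t - X a t) + integral {a..b} (\<lambda>x. T x d - T x c)"
proof -
  have box: "{a..b} \<times> {c..d} = cbox (a, c) (b, d)"
    by (simp add: cbox_Pair_eq)
  have Xint: "integral {a..b} (\<lambda>x. Xx x t) = X b t - X a t" if "t \<in> {c..d}" for t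
    using fundamental_theorem_of_calculus[OF assms(1), of "\<lambda>x. X x t" "\<lambda>x. Xx x t"] X that
    by (intro integral_unique) (simp add: has_real_derivative_iff_has_vector_derivative)
  have Tint: "integral {c..d} (Tt x) = T x d - T x c" if "x \<in> {a..b}" for x
    using fundamental_theorem_of_calculus[OF assms(2), of "\<lambda>t. T x t" "\<lambda>t. Tt x t"] T that
    by (intro integral_unique) (simp add: has_real_derivative_iff_has_vector_derivative)
  have "integral ({a..b} \<times> {c..d}) (\<lambda>(x, t). Xx x t + Tt x t)
      = integral ({a..b} \<times> {c..d}) (\<lambda>(x, t). Xx x t) + integral ({a..b} \<times> {c..d}) (\<lambda>(x, t). Tt x t)"
    using integral_add[OF integrable_continuous integrable_continuous, of "(a, c)" "(b, d)"
        "\<lambda>(x, t). Xx x t" "\<lambda>(x, t). Tt x t"] Xc Tc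
    by (simp add: box case_prod_unfold)
  moreover have "integral ({a..b} \<times> {c..d}) (\<lambda>(x, t). Tt x t)
      = integral {a..b} (\<lambda>x. integral {c..d} (Tt x))"
    using integral_prod_continuous[of a c b d "\<lambda>(x, t). Tt x t"] Tc
    unfolding box by (simp add: box_real)
  moreover have "\<dots> = integral {a..b} (\<lambda>x. T x d - T x c)"
    by (rule Henstock_Kurzweil_Integration.integral_cong) (rule Tint)
  moreover have "integral ({a..b} \<times> {c..d}) (\<lambda>(x, t). Xx x t)
      = integral {c..d} (\<lambda>t. integral {a..b} (\<lambda>x. Xx x t))"
    using integral_prod_continuous[of a c b d "\<lambda>(x, t). Xx x t"]
      integral_swap_continuous[of a c b d Xx] Xc
    unfolding box by (simp add: box_real)
  moreover have "\<dots> = integral {c..d} (\<lambda>t. X b t - X a t)"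
    by (rule Henstock_Kurzweil_Integration.integral_cong) (rule Xint)
  ultimately show ?thesis
    by simp
qed

text \<open>Integrate the pointwise bound over the rectangle. The Cauchy data remove only the edge
  \<open>x = 0\<close>; the fluxes through the other three edges are kept, to be dominated later by
  the choice of weight.\<close>

lemma carleman_estimate:
  fixes z zx zt zxx zxt :: "real \<Rightarrow> real \<Rightarrow> complex" and p g :: "real \<Rightarrow> real"
  assumes "0 \<le> a" "c \<le> d" "\<tau> \<ge> 0"
    and cont: "continuous_on ({0..a} \<times> {c..d}) (\<lambda>(x, t). z x t)"
      "continuous_on ({0..a} \<times> {c..d}) (\<lambda>(x, t). zx x t)"
      "continuous_on ({0..a} \<times> {c..d}) (\<lambda>(x, t). zt x t)"
      "continuous_on ({0..a} \<times> {c..d}) (\<lambda>(x, t). zxx x t)"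
      "continuous_on ({0..a} \<times> {c..d}) (\<lambda>(x, t). zxt x t)"
    and deriv: "\<And>x t. x \<in> {0..a} \<Longrightarrow> t \<in> {c..d} \<Longrightarrow>
        ((\<lambda>x. z x t) has_vector_derivative zx x t) (at x within {0..a})"
      "\<And>x t. x \<in> {0..a} \<Longrightarrow> t \<in> {c..d} \<Longrightarrow>
        ((\<lambda>x. zx x t) has_vector_derivative zxx x t) (at x within {0..a})"
      "\<And>x t. x \<in> {0..a} \<Longrightarrow> t \<in> {c..d} \<Longrightarrow>
        ((\<lambda>x. zt x t) has_vector_derivative zxt x t) (at x within {0..a})"
      "\<And>x t. x \<in> {0..a} \<Longrightarrow> t \<in> {c..d} \<Longrightarrow>
        ((\<lambda>t. z x t) has_vector_derivative zt x t) (at t within {c..d})"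
      "\<And>x t. x \<in> {0..a} \<Longrightarrow> t \<in> {c..d} \<Longrightarrow>
        ((\<lambda>t. zx x t) has_vector_derivative zxt x t) (at t within {c..d})"
    and p: "\<And>x. (p has_real_derivative 2 * \<tau>) (at x within {0..a})"
    and g: "\<And>t. (g has_real_derivative - \<kappa>) (at t within {c..d})"
    and zero: "\<And>t. t \<in> {c..d} \<Longrightarrow> z 0 t = 0" "\<And>t. t \<in> {c..d} \<Longrightarrow> zx 0 t = 0"
  shows "integral ({0..a} \<times> {c..d}) (\<lambda>(x, t). (8 * \<tau> * (p x)\<^sup>2 - \<kappa>) * (cmod (z x t))\<^sup>2)
       + integral {c..d} (\<lambda>t. carleman_flux_x \<tau> (p a) (g t) (z a t) (zx a t) (zt a t))
       + integral {0..a} (\<lambda>x. carleman_flux_t (p x) (g d) (z x d) (zx x d)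
                               - carleman_flux_t (p x) (g c) (z x c) (zx x c))
     \<le> integral ({0..a} \<times> {c..d})
         (\<lambda>(x, t). (cmod (\<i> * zt x t + zxx x t + of_real ((p x)\<^sup>2) * z x t
               - (of_real (2 * p x) * zx x t + of_real (2 * \<tau>) * z x t
                  + \<i> * of_real (g t) * z x t)))\<^sup>2)"
proof -
  define Q where "Q = {0..a} \<times> {c..d}"
  have box: "Q = cbox (0, c) (a, d)"
    by (simp add: Q_def cbox_Pair_eq)
  let ?X = "\<lambda>x t. carleman_flux_x \<tau> (p x) (g t) (z x t) (zx x t) (zt x t)"
  let ?T = "\<lambda>x t. carleman_flux_t (p x) (g t) (z x t) (zx x t)"
  let ?Xx = "\<lambda>x t. carleman_flux_x_deriv \<tau> (p x) (g t) (z x t) (zx x t) (zt x t) (zxx x t) (zxt x t)"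
  let ?Tt = "\<lambda>x t. carleman_flux_t_deriv \<kappa> (p x) (g t) (z x t) (zx x t) (zt x t) (zxt x t)"
  let ?L = "\<lambda>x t. (cmod (\<i> * zt x t + zxx x t + of_real ((p x)\<^sup>2) * z x t
               - (of_real (2 * p x) * zx x t + of_real (2 * \<tau>) * z x t
                  + \<i> * of_real (g t) * z x t)))\<^sup>2"
  have pc: "continuous_on {0..a} p" and gc: "continuous_on {c..d} g"
    using p g by (meson DERIV_continuous_on)+
  have pc2: "continuous_on Q (\<lambda>q. p (fst q))" and gc2: "continuous_on Q (\<lambda>q. g (snd q))"
    by (rule continuous_on_compose2[OF pc] continuous_on_compose2[OF gc];
        force simp: Q_def intro!: continuous_intros)+
  note cont' = cont[folded Q_def, THEN continuous_on_case_prodD] pc2 gc2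
  have cX: "continuous_on Q (\<lambda>(x, t). ?Xx x t)"
    unfolding case_prod_unfold carleman_flux_x_deriv_def
    by (intro continuous_intros cont')
  have cT: "continuous_on Q (\<lambda>(x, t). ?Tt x t)"
    unfolding case_prod_unfold carleman_flux_t_deriv_def
    by (intro continuous_intros cont')
  have cL: "continuous_on Q (\<lambda>(x, t). ?L x t)"
    unfolding case_prod_unfold
    by (intro continuous_intros cont')
  have cZ: "continuous_on Q (\<lambda>(x, t). (8 * \<tau> * (p x)\<^sup>2 - \<kappa>) * (cmod (z x t))\<^sup>2)"
    unfolding case_prod_unfold
    by (intro continuous_intros cont')
  have div: "integral Q (\<lambda>(x, t). ?Xx x t + ?Tt x t) =
      integral {c..d} (\<lambda>t. ?X a t - ?X 0 t) + integral {0..a} (\<lambda>x. ?T x d - ?T x c)"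
    unfolding Q_def
  proof (rule integral_divergence_rectangle)
    show "((\<lambda>x. ?X x t) has_real_derivative ?Xx x t) (at x within {0..a})"
      if "x \<in> {0..a}" "t \<in> {c..d}" for x t
      using that by (intro carleman_flux_x_has_derivative deriv p)
    show "((\<lambda>t. ?T x t) has_real_derivative ?Tt x t) (at t within {c..d})"
      if "x \<in> {0..a}" "t \<in> {c..d}" for x t
      using that by (intro carleman_flux_t_has_derivative deriv g)
  qed (use assms cX cT in \<open>simp_all add: Q_def\<close>)
  \<comment> \<open>Each term of the x-flux contains \<open>z\<close> or \<open>zx\<close> as a
    factor, so the flux through \<open>x = 0\<close> vanishes.\<close>
  have X: "integral {c..d} (\<lambda>t. ?X a t - ?X 0 t) = integral {c..d} (\<lambda>t. ?X a t)"
    using zero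
    by (intro Henstock_Kurzweil_Integration.integral_cong) (simp add: carleman_flux_x_def)
  have "integral Q (\<lambda>(x, t). (8 * \<tau> * (p x)\<^sup>2 - \<kappa>) * (cmod (z x t))\<^sup>2)
      + integral Q (\<lambda>(x, t). ?Xx x t + ?Tt x t)
      = integral Q (\<lambda>q. (case q of (x, t) \<Rightarrow> (8 * \<tau> * (p x)\<^sup>2 - \<kappa>) * (cmod (z x t))\<^sup>2)
           + (case q of (x, t) \<Rightarrow> ?Xx x t + ?Tt x t))"
    using cX cT cZ unfolding box
    by (intro integral_add[symmetric] integrable_continuous)
       (auto simp: case_prod_unfold intro!: continuous_intros)
  also have "\<dots> \<le> integral Q (\<lambda>(x, t). ?L x t)"
  proof (rule integral_le)
    show "(\<lambda>q. (case q of (x, t) \<Rightarrow> (8 * \<tau> * (p x)\<^sup>2 - \<kappa>) * (cmod (z x t))\<^sup>2)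
           + (case q of (x, t) \<Rightarrow> ?Xx x t + ?Tt x t)) integrable_on Q"
      using cX cT cZ unfolding box
      by (intro integrable_continuous)
         (auto simp: case_prod_unfold intro!: continuous_intros)
    show "(\<lambda>(x, t). ?L x t) integrable_on Q"
      using cL unfolding box by (rule integrable_continuous)
  next
    fix q assume "q \<in> Q"
    show "(case q of (x, t) \<Rightarrow> (8 * \<tau> * (p x)\<^sup>2 - \<kappa>) * (cmod (z x t))\<^sup>2)
           + (case q of (x, t) \<Rightarrow> ?Xx x t + ?Tt x t) \<le> (case q of (x, t) \<Rightarrow> ?L x t)"
      unfolding case_prod_unfold add.assoc[symmetric]
      by (rule carleman_pointwise[OF \<open>\<tau> \<ge> 0\<close>])
  qed
  finally show ?thesis
    unfolding div X by (simp add: Q_def add.assoc)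
qed

lemma integral_abs_bound:
  fixes f :: "real \<Rightarrow> real"
  assumes "\<And>t. t \<in> {c..d} \<Longrightarrow> \<bar>f t\<bar> \<le> C" "c \<le> d" "0 \<le> C"
  shows "\<bar>integral {c..d} f\<bar> \<le> C * (d - c)"
proof (cases "f integrable_on {c..d}")
  case True
  have "norm (integral {c..d} f) \<le> integral {c..d} (\<lambda>_. C)"
    by (rule integral_norm_bound_integral[OF True]) (use assms in auto)
  then show ?thesis
    using assms by (simp add: mult.commute)
next
  \<comment> \<open>A non-integrable function has integral 0 by convention, and the bound is
    nonnegative. Hence the edge fluxes can be estimated without a proof that they are
    integrable.\<close>
  case False
  then show ?thesis
    using assms by (simp add: not_integrable_integral)
qed

text \<open>With \<open>\<sigma> = P \<tau> \<ge> 1\<close> every monomial is at most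
  \<open>\<sigma>^3 n^2\<close>. The constant 12 is the sum 2 + 2 + 4 + 2 + 2 of the coefficients of
  the x-flux; the t-flux needs only 2 + 1.\<close>

lemma carleman_flux_bounds:
  fixes z zx zt :: complex
  assumes "\<tau> \<ge> 1" "P \<ge> 1" "\<bar>p\<bar> \<le> P * \<tau>" "\<bar>g\<bar> \<le> P * \<tau>"
    and "cmod z \<le> n" "cmod zx \<le> P * \<tau> * n" "cmod zt \<le> P * \<tau> * n"
  shows "\<bar>carleman_flux_x \<tau> p g z zx zt\<bar> \<le> 12 * P ^ 3 * \<tau> ^ 3 * n\<^sup>2"
    and "\<bar>carleman_flux_t p g z zx\<bar> \<le> 12 * P ^ 3 * \<tau> ^ 3 * n\<^sup>2"
proof -
  define \<sigma> where "\<sigma> = P * \<tau>"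
  have \<sigma>: "\<sigma> \<ge> 1" "\<tau> \<le> \<sigma>"
    using assms(1,2) mult_mono[of 1 P 1 \<tau>] mult_mono[of 1 P \<tau> \<tau>] by (auto simp: \<sigma>_def)
  have n: "n \<ge> 0"
    using assms(5) norm_ge_zero order_trans by blast
  note b = assms(3-7)[folded \<sigma>_def]
  have pw: "\<sigma> \<le> \<sigma> ^ 3" "\<sigma>\<^sup>2 \<le> \<sigma> ^ 3"
    using \<sigma> power_increasing[of 1 3 \<sigma>] power_increasing[of 2 3 \<sigma>] by auto
  have t1: "\<bar>p * Im (z * cnj zt)\<bar> \<le> \<sigma> * (n * (\<sigma> * n))"
    unfolding abs_mult using b \<sigma> n
    by (intro mult_mono order_trans[OF abs_Im_le_cmod]) (auto simp: norm_mult intro!: mult_mono)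
  have t2: "\<bar>p * (cmod zx)\<^sup>2\<bar> \<le> \<sigma> * (\<sigma> * n)\<^sup>2"
    unfolding abs_mult using b \<sigma> n by (intro mult_mono) (auto intro!: power_mono)
  have t3: "\<bar>\<tau> * Re (zx * cnj z)\<bar> \<le> \<sigma> * (\<sigma> * n * n)"
    unfolding abs_mult using b \<sigma> n assms(1)
    by (intro mult_mono order_trans[OF abs_Re_le_cmod]) (auto simp: norm_mult intro!: mult_mono)
  have t4: "\<bar>g * Im (zx * cnj z)\<bar> \<le> \<sigma> * (\<sigma> * n * n)"
    unfolding abs_mult using b \<sigma> n
    by (intro mult_mono order_trans[OF abs_Im_le_cmod]) (auto simp: norm_mult intro!: mult_mono)
  have t5: "\<bar>p ^ 3 * (cmod z)\<^sup>2\<bar> \<le> \<sigma> ^ 3 * n\<^sup>2"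
    unfolding abs_mult power_abs using b \<sigma> n by (intro mult_mono power_mono) auto
  have t6: "\<bar>p * Im (z * cnj zx)\<bar> \<le> \<sigma> * (n * (\<sigma> * n))"
    unfolding abs_mult using b \<sigma> n
    by (intro mult_mono order_trans[OF abs_Im_le_cmod]) (auto simp: norm_mult intro!: mult_mono)
  have t7: "\<bar>g * (cmod z)\<^sup>2\<bar> \<le> \<sigma> * n\<^sup>2"
    unfolding abs_mult using b \<sigma> n by (intro mult_mono power_mono) auto
  have e: "\<sigma> * (n * (\<sigma> * n)) = \<sigma>\<^sup>2 * n\<^sup>2" "\<sigma> * (\<sigma> * n)\<^sup>2 = \<sigma> ^ 3 * n\<^sup>2" "\<sigma> * (\<sigma> * n * n) = \<sigma>\<^sup>2 * n\<^sup>2"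
    by (simp_all add: power2_eq_square power3_eq_cube)
  have m: "\<sigma>\<^sup>2 * n\<^sup>2 \<le> \<sigma> ^ 3 * n\<^sup>2" "\<sigma> * n\<^sup>2 \<le> \<sigma> ^ 3 * n\<^sup>2"
    using pw by (auto intro: mult_right_mono)
  have s: "12 * P ^ 3 * \<tau> ^ 3 * n\<^sup>2 = 12 * (\<sigma> ^ 3 * n\<^sup>2)"
    by (simp add: \<sigma>_def power_mult_distrib)
  show "\<bar>carleman_flux_x \<tau> p g z zx zt\<bar> \<le> 12 * P ^ 3 * \<tau> ^ 3 * n\<^sup>2"
    unfolding s carleman_flux_x_def using t1 t2 t3 t4 t5 m unfolding e unfolding mult.assoc by linarith
  show "\<bar>carleman_flux_t p g z zx\<bar> \<le> 12 * P ^ 3 * \<tau> ^ 3 * n\<^sup>2"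
    unfolding s carleman_flux_t_def using t6 t7 m unfolding e unfolding mult.assoc by linarith
qed

section \<open>Unique continuation from the line \<open>x = 0\<close>\<close>

text \<open>Here \<open>w\<close> stands for the difference of two solutions; the nonlinearity
  survives only through the inequality \<open>ineq\<close>. That \<open>wxt\<close> is both the
  x-derivative of \<open>wt\<close> and the t-derivative of \<open>wx\<close> builds in the equality
  of mixed derivatives.\<close>

locale vanishing_cauchy_data =
  fixes w wx wt wxx wxt :: "real \<Rightarrow> real \<Rightarrow> complex" and a t1 \<delta> M :: real
  assumes a: "a > 0" and \<delta>: "\<delta> > 0"
    and cont: "continuous_on ({0..a} \<times> {t1-\<delta>..t1+\<delta>}) (\<lambda>(x, t). w x t)"
      "continuous_on ({0..a} \<times> {t1-\<delta>..t1+\<delta>}) (\<lambda>(x, t). wx x t)"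
      "continuous_on ({0..a} \<times> {t1-\<delta>..t1+\<delta>}) (\<lambda>(x, t). wt x t)"
      "continuous_on ({0..a} \<times> {t1-\<delta>..t1+\<delta>}) (\<lambda>(x, t). wxx x t)"
      "continuous_on ({0..a} \<times> {t1-\<delta>..t1+\<delta>}) (\<lambda>(x, t). wxt x t)"
    and deriv: "\<And>x t. x \<in> {0..a} \<Longrightarrow> t \<in> {t1-\<delta>..t1+\<delta>} \<Longrightarrow>
        ((\<lambda>x. w x t) has_vector_derivative wx x t) (at x within {0..a})"
      "\<And>x t. x \<in> {0..a} \<Longrightarrow> t \<in> {t1-\<delta>..t1+\<delta>} \<Longrightarrow>
        ((\<lambda>x. wx x t) has_vector_derivative wxx x t) (at x within {0..a})"
      "\<And>x t. x \<in> {0..a} \<Longrightarrow> t \<in> {t1-\<delta>..t1+\<delta>} \<Longrightarrow>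
        ((\<lambda>x. wt x t) has_vector_derivative wxt x t) (at x within {0..a})"
      "\<And>x t. x \<in> {0..a} \<Longrightarrow> t \<in> {t1-\<delta>..t1+\<delta>} \<Longrightarrow>
        ((\<lambda>t. w x t) has_vector_derivative wt x t) (at t within {t1-\<delta>..t1+\<delta>})"
      "\<And>x t. x \<in> {0..a} \<Longrightarrow> t \<in> {t1-\<delta>..t1+\<delta>} \<Longrightarrow>
        ((\<lambda>t. wx x t) has_vector_derivative wxt x t) (at t within {t1-\<delta>..t1+\<delta>})"
    and zero: "\<And>t. t \<in> {t1-\<delta>..t1+\<delta>} \<Longrightarrow> w 0 t = 0" "\<And>t. t \<in> {t1-\<delta>..t1+\<delta>} \<Longrightarrow> wx 0 t = 0"
    and ineq: "\<And>x t. x \<in> {0..a} \<Longrightarrow> t \<in> {t1-\<delta>..t1+\<delta>} \<Longrightarrow>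
        cmod (\<i> * wt x t + wxx x t) \<le> M * cmod (w x t)"
begin

text \<open>This \<open>B\<close> makes \<open>\<phi> \<le> 1\<close> on all edges of \<open>Q\<close> but \<open>x = 0\<close>, whereas \<open>\<phi> > 1\<close> at \<open>(x, t1)\<close> for \<open>x < a\<close>.\<close>

definition "B = ((a + 1) / \<delta>)\<^sup>2"

definition "\<phi> x t = (a + 1 - x)\<^sup>2 - B * (t - t1)\<^sup>2"

abbreviation "Q \<equiv> {0..a} \<times> {t1-\<delta>..t1+\<delta>}"

definition "E \<tau> = integral Q (\<lambda>(x, t). exp (2 * \<tau> * \<phi> x t) * (cmod (w x t))\<^sup>2)"

lemma B_nonneg: "B \<ge> 0"
  by (simp add: B_def)

lemma Q_box: "Q = cbox (0, t1-\<delta>) (a, t1+\<delta>)"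
  by (simp add: cbox_Pair_eq)

lemma cont_\<phi>: "continuous_on S (\<lambda>q. \<phi> (fst q) (snd q))"
  unfolding \<phi>_def by (intro continuous_intros)

text \<open>At \<open>t = t1 - \<delta>\<close> and \<open>t = t1 + \<delta>\<close> the term
  \<open>B \<delta>^2 = (a + 1)^2\<close> cancels the largest possible square, and at
  \<open>x = a\<close> the square is 1.\<close>

lemma \<phi>_edge: "t \<in> {t1-\<delta>..t1+\<delta>} \<Longrightarrow> \<phi> a t \<le> 1"
  "x \<in> {0..a} \<Longrightarrow> \<phi> x (t1-\<delta>) \<le> 1" "x \<in> {0..a} \<Longrightarrow> \<phi> x (t1+\<delta>) \<le> 1"
proof -
  have "(a + 1 - x)\<^sup>2 \<le> (a + 1)\<^sup>2" if "x \<in> {0..a}"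
    using that by (intro power_mono) auto
  moreover have "B * \<delta>\<^sup>2 = (a + 1)\<^sup>2"
    using \<delta> by (simp add: B_def power_divide)
  ultimately show "x \<in> {0..a} \<Longrightarrow> \<phi> x (t1-\<delta>) \<le> 1" "x \<in> {0..a} \<Longrightarrow> \<phi> x (t1+\<delta>) \<le> 1"
    by (simp_all add: \<phi>_def add_increasing2 del: atLeastAtMost_iff)
  show "t \<in> {t1-\<delta>..t1+\<delta>} \<Longrightarrow> \<phi> a t \<le> 1"
    using B_nonneg by (simp add: \<phi>_def)
qed

lemma bounded_derivatives:
  obtains m where "m \<ge> 0" "\<And>x t. (x, t) \<in> Q \<Longrightarrow> cmod (w x t) \<le> m \<and> cmod (wx x t) \<le> m \<and> cmod (wt x t) \<le> m"
proof -
  have "compact Q"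
    unfolding Q_box by (rule compact_cbox)
  then have "bounded ((\<lambda>(x, t). f x t) ` Q)" if "continuous_on Q (\<lambda>(x, t). f x t)" 
    for f :: "real \<Rightarrow> real \<Rightarrow> complex"
    using that compact_continuous_image compact_imp_bounded by blast
  then have "\<exists>m. \<forall>x t. (x, t) \<in> Q \<longrightarrow> cmod (f x t) \<le> m" if "continuous_on Q (\<lambda>(x, t). f x t)" 
    for f :: "real \<Rightarrow> real \<Rightarrow> complex"
    using that unfolding bounded_iff by fastforce
  from this[OF cont(1)] this[OF cont(2)] this[OF cont(3)]
  obtain m1 m2 m3 where "\<forall>x t. (x, t) \<in> Q \<longrightarrow> cmod (w x t) \<le> m1"
    "\<forall>x t. (x, t) \<in> Q \<longrightarrow> cmod (wx x t) \<le> m2" "\<forall>x t. (x, t) \<in> Q \<longrightarrow> cmod (wt x t) \<le> m3"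
    by blast
  then show ?thesis
    by (intro that[of "max 0 (max m1 (max m2 m3))"]) (auto simp: le_max_iff_disj)
qed

text \<open>The Carleman estimate for \<open>z = e^(\<tau> \<phi>) w\<close>: the interior term is
  at least \<open>(32 \<tau>^3 - 2 B \<tau>) E \<tau>\<close>, the right-hand side is at most
  \<open>M^2 E \<tau>\<close>, and the three edges contribute
  \<open>O(\<tau>^3 e^(2 \<tau>))\<close> because \<open>\<phi> \<le> 1\<close> there. The constant
  \<open>K\<close> is independent of \<open>\<tau>\<close>.\<close>

lemma weighted_energy_le:
  "\<exists>K. \<forall>\<tau>\<ge>1. (32 * \<tau> ^ 3 - 2 * B * \<tau> - M\<^sup>2) * E \<tau> \<le> K * \<tau> ^ 3 * exp (2 * \<tau>)"
proof -
  obtain m where m: "m \<ge> 0" "\<And>x t. (x, t) \<in> Q \<Longrightarrow> cmod (w x t) \<le> m"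
    "\<And>x t. (x, t) \<in> Q \<Longrightarrow> cmod (wx x t) \<le> m" "\<And>x t. (x, t) \<in> Q \<Longrightarrow> cmod (wt x t) \<le> m"
    by (metis bounded_derivatives)
  \<comment> \<open>On \<open>Q\<close> one has \<open>|p| \<le> 2 (a + 1) \<tau>\<close> and
    \<open>|g| \<le> 2 B \<delta> \<tau>\<close>. The extra 1 absorbs the terms \<open>wx\<close>
    and \<open>wt\<close> in the derivatives of \<open>z\<close>.\<close>
  define P where "P = 1 + 2 * (a + 1) + 2 * B * \<delta>"
  have P1: "P \<ge> 1"
    using a \<delta> B_nonneg by (simp add: P_def)
  have P2: "1 + 2 * (a + 1) \<le> P" "1 + 2 * B * \<delta> \<le> P"
    using a \<delta> B_nonneg by (simp_all add: P_def)
  have "(32 * \<tau> ^ 3 - 2 * B * \<tau> - M\<^sup>2) * E \<tau> \<le> 12 * P ^ 3 * m\<^sup>2 * (2 * \<delta> + 2 * a) * \<tau> ^ 3 * exp (2 * \<tau>)"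
    if \<tau>: "\<tau> \<ge> 1" for \<tau>
  proof -
    define e where "e x t = exp (\<tau> * \<phi> x t)" for x t
    define p where "p x = 2 * \<tau> * (x - (a + 1))" for x
    define g where "g t = - 2 * \<tau> * B * (t - t1)" for t
    \<comment> \<open>The next four functions are the derivatives of \<open>z\<close>, from the
      product rule with \<open>e_x = p e\<close>, \<open>e_t = g e\<close>,
      \<open>p_x = 2 \<tau>\<close> and \<open>p_t = g_x = 0\<close>.\<close>
    define z where "z x t = of_real (e x t) * w x t" for x t
    define zx where "zx x t = of_real (e x t) * (wx x t + of_real (p x) * w x t)" for x t
    define zt where "zt x t = of_real (e x t) * (wt x t + of_real (g t) * w x t)" for x t
    define zxx where "zxx x t = of_real (e x t) *
      (wxx x t + 2 * of_real (p x) * wx x t + (of_real (2 * \<tau>) + of_real (p x) ^ 2) * w x t)" for x t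
    define zxt where "zxt x t = of_real (e x t) *
      (wxt x t + of_real (p x) * wt x t + of_real (g t) * wx x t + of_real (p x) * of_real (g t) * w x t)" for x t
    have ex: "((\<lambda>x. of_real (e x t) :: complex) has_vector_derivative of_real (e x t * p x)) (at x within S)" for x t S
      unfolding e_def \<phi>_def p_def
      by (auto intro!: derivative_eq_intros has_vector_derivative_real_field simp: algebra_simps)
    have et: "((\<lambda>t. of_real (e x t) :: complex) has_vector_derivative of_real (e x t * g t)) (at t within S)" for x t S
      unfolding e_def \<phi>_def g_def
      by (auto intro!: derivative_eq_intros simp: algebra_simps)
    have px: "(p has_real_derivative 2 * \<tau>) (at x within S)" for x S
      unfolding p_def by (auto intro!: derivative_eq_intros)
    have gt: "(g has_real_derivative - (2 * B * \<tau>)) (at t within S)" for t S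
      unfolding g_def by (auto intro!: derivative_eq_intros)
    note px' = has_vector_derivative_of_real[OF px]
    note gt' = has_vector_derivative_of_real[OF gt]
    note hvd_mult = has_vector_derivative_mult and hvd_add = has_vector_derivative_add
    note hvd = has_vector_derivative_eq_rhs
    have dz: 
      "((\<lambda>x. z x t) has_vector_derivative zx x t) (at x within {0..a})"
      "((\<lambda>x. zx x t) has_vector_derivative zxx x t) (at x within {0..a})"
      "((\<lambda>x. zt x t) has_vector_derivative zxt x t) (at x within {0..a})"
      "((\<lambda>t. z x t) has_vector_derivative zt x t) (at t within {t1-\<delta>..t1+\<delta>})"
      "((\<lambda>t. zx x t) has_vector_derivative zxt x t) (at t within {t1-\<delta>..t1+\<delta>})"
      if xt: "x \<in> {0..a}" "t \<in> {t1-\<delta>..t1+\<delta>}" for x t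
    proof -
      note dw = deriv[OF xt]
      note dp = hvd_add[OF dw(2) hvd_mult[OF px'[of x "{0..a}"] dw(1)]]
      note dg = hvd_add[OF dw(3) hvd_mult[OF has_vector_derivative_const[of "of_real (g t)"] dw(1)]]
      note dt = hvd_add[OF dw(5) hvd_mult[OF has_vector_derivative_const[of "of_real (p x)"] dw(4)]]
      show "((\<lambda>x. z x t) has_vector_derivative zx x t) (at x within {0..a})"
        unfolding z_def zx_def
        by (rule hvd[OF hvd_mult[OF ex dw(1)]]) (simp add: algebra_simps)
      show "((\<lambda>x. zx x t) has_vector_derivative zxx x t) (at x within {0..a})"
        unfolding zx_def zxx_def
        by (rule hvd[OF hvd_mult[OF ex dp]]) (simp add: algebra_simps power2_eq_square)
      show "((\<lambda>x. zt x t) has_vector_derivative zxt x t) (at x within {0..a})"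
        unfolding zt_def zxt_def
        by (rule hvd[OF hvd_mult[OF ex dg]]) (simp add: algebra_simps power2_eq_square)
      show "((\<lambda>t. z x t) has_vector_derivative zt x t) (at t within {t1-\<delta>..t1+\<delta>})"
        unfolding z_def zt_def
        by (rule hvd[OF hvd_mult[OF et dw(4)]]) (simp add: algebra_simps)
      show "((\<lambda>t. zx x t) has_vector_derivative zxt x t) (at t within {t1-\<delta>..t1+\<delta>})"
        unfolding zx_def zxt_def
        by (rule hvd[OF hvd_mult[OF et dt]]) (simp add: algebra_simps power2_eq_square)
    qed
    note cw = cont[THEN continuous_on_case_prodD]
    have ce: "continuous_on Q (\<lambda>q. e (fst q) (snd q))"
      unfolding e_def by (intro continuous_intros cont_\<phi>)
    have cp: "continuous_on Q (\<lambda>q. p (fst q))" and cg: "continuous_on Q (\<lambda>q. g (snd q))"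
      unfolding p_def g_def by (intro continuous_intros)+
    have cz: "continuous_on Q (\<lambda>(x, t). z x t)" "continuous_on Q (\<lambda>(x, t). zx x t)"
      "continuous_on Q (\<lambda>(x, t). zt x t)" "continuous_on Q (\<lambda>(x, t). zxx x t)"
      "continuous_on Q (\<lambda>(x, t). zxt x t)"
      unfolding case_prod_unfold z_def zx_def zt_def zxx_def zxt_def
      by (intro continuous_intros cw ce cp cg)+
    have zero': "z 0 t = 0" "zx 0 t = 0" if "t \<in> {t1-\<delta>..t1+\<delta>}" for t
      using zero[OF that] by (simp_all add: z_def zx_def)
    define I1 where "I1 = integral Q (\<lambda>(x, t). (8 * \<tau> * (p x)\<^sup>2 - 2 * B * \<tau>) * (cmod (z x t))\<^sup>2)"
    define I2 where "I2 = integral {t1-\<delta>..t1+\<delta>} (\<lambda>t. carleman_flux_x \<tau> (p a) (g t) (z a t) (zx a t) (zt a t))"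
    define I3 where "I3 = integral {0..a} (\<lambda>x. carleman_flux_t (p x) (g (t1+\<delta>)) (z x (t1+\<delta>)) (zx x (t1+\<delta>))
                               - carleman_flux_t (p x) (g (t1-\<delta>)) (z x (t1-\<delta>)) (zx x (t1-\<delta>)))"
    have est: "I1 + I2 + I3 \<le> integral Q (\<lambda>(x, t). (cmod (\<i> * zt x t + zxx x t + of_real ((p x)\<^sup>2) * z x t
               - (of_real (2 * p x) * zx x t + of_real (2 * \<tau>) * z x t
                  + \<i> * of_real (g t) * z x t)))\<^sup>2)"
      unfolding I1_def I2_def I3_def
      by (rule carleman_estimate[OF _ _ _ cz dz px gt zero']) (use a \<delta> \<tau> in auto)
    \<comment> \<open>The conjugated operator applied to \<open>z\<close> is the weight times the
      original operator applied to \<open>w\<close>: all terms with \<open>p\<close>,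
      \<open>g\<close> and \<open>\<tau>\<close> cancel.\<close>
    have L: "\<i> * zt x t + zxx x t + of_real ((p x)\<^sup>2) * z x t
               - (of_real (2 * p x) * zx x t + of_real (2 * \<tau>) * z x t
                  + \<i> * of_real (g t) * z x t) = of_real (e x t) * (\<i> * wt x t + wxx x t)" for x t
      unfolding z_def zx_def zt_def zxx_def
      by (simp add: algebra_simps power2_eq_square)
    have e2: "(e x t)\<^sup>2 = exp (2 * \<tau> * \<phi> x t)" and e0: "e x t > 0" for x t
      by (simp_all add: e_def power2_eq_square flip: exp_add)
    have cE: "continuous_on Q (\<lambda>(x, t). exp (2 * \<tau> * \<phi> x t) * (cmod (w x t))\<^sup>2)"
      unfolding case_prod_unfold by (intro continuous_intros cont_\<phi> cw)
    note iE = integrable_continuous[OF cE[unfolded Q_box], folded Q_box]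
    have cL: "continuous_on Q (\<lambda>(x, t). (cmod (of_real (e x t) * (\<i> * wt x t + wxx x t)))\<^sup>2)"
      unfolding case_prod_unfold by (intro continuous_intros ce cw)
    note iL = integrable_continuous[OF cL[unfolded Q_box], folded Q_box]
    have cI1: "continuous_on Q (\<lambda>(x, t). (8 * \<tau> * (p x)\<^sup>2 - 2 * B * \<tau>) * (cmod (z x t))\<^sup>2)"
      unfolding case_prod_unfold by (intro continuous_intros cp cz[THEN continuous_on_case_prodD])
    note iI1 = integrable_continuous[OF cI1[unfolded Q_box], folded Q_box]
    have "integral Q (\<lambda>(x, t). (cmod (of_real (e x t) * (\<i> * wt x t + wxx x t)))\<^sup>2)
        \<le> integral Q (\<lambda>q. M\<^sup>2 * (case q of (x, t) \<Rightarrow> exp (2 * \<tau> * \<phi> x t) * (cmod (w x t))\<^sup>2))"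
    proof (rule integral_le[OF iL integrable_on_mult_right[OF iE]])
      fix q assume "q \<in> Q"
      then have "cmod (\<i> * wt (fst q) (snd q) + wxx (fst q) (snd q)) \<le> M * cmod (w (fst q) (snd q))"
        by (intro ineq) auto
      then have "(cmod (\<i> * wt (fst q) (snd q) + wxx (fst q) (snd q)))\<^sup>2 \<le> M\<^sup>2 * (cmod (w (fst q) (snd q)))\<^sup>2"
        using power_mono[of _ _ 2] by (fastforce simp: power_mult_distrib)
      then show "(case q of (x, t) \<Rightarrow> (cmod (of_real (e x t) * (\<i> * wt x t + wxx x t)))\<^sup>2)
          \<le> M\<^sup>2 * (case q of (x, t) \<Rightarrow> exp (2 * \<tau> * \<phi> x t) * (cmod (w x t))\<^sup>2)"
        unfolding e2[symmetric] using mult_left_mono[of _ _ "(e (fst q) (snd q))\<^sup>2"]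
        by (fastforce simp: case_prod_unfold norm_mult power_mult_distrib mult.left_commute)
    qed
    then have R: "integral Q (\<lambda>(x, t). (cmod (of_real (e x t) * (\<i> * wt x t + wxx x t)))\<^sup>2) \<le> M\<^sup>2 * E \<tau>"
      by (simp add: E_def)
    have "integral Q (\<lambda>q. (32 * \<tau> ^ 3 - 2 * B * \<tau>) * (case q of (x, t) \<Rightarrow> exp (2 * \<tau> * \<phi> x t) * (cmod (w x t))\<^sup>2)) \<le> I1"
      unfolding I1_def
    proof (rule integral_le[OF integrable_on_mult_right[OF iE] iI1])
      fix q assume q: "q \<in> Q"
      \<comment> \<open>Since \<open>a + 1 - x \<ge> 1\<close> on \<open>Q\<close>, the slope
        satisfies \<open>|p| \<ge> 2 \<tau>\<close>; this turns \<open>8 \<tau> p^2\<close> into at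
        least \<open>32 \<tau>^3\<close>.\<close>
      have "(2 * \<tau>)\<^sup>2 \<le> (p (fst q))\<^sup>2"
      proof (rule abs_le_square_iff[THEN iffD1])
        have "\<bar>p (fst q)\<bar> = 2 * \<tau> * (a + 1 - fst q)"
          using q \<tau> by (auto simp: p_def abs_mult)
        also have "\<dots> \<ge> 2 * \<tau> * 1"
          using q \<tau> by (intro mult_left_mono) auto
        finally show "\<bar>2 * \<tau>\<bar> \<le> \<bar>p (fst q)\<bar>"
          using \<tau> by simp
      qed
      then have "8 * \<tau> * (2 * \<tau>)\<^sup>2 \<le> 8 * \<tau> * (p (fst q))\<^sup>2"
        using \<tau> by (intro mult_left_mono) auto
      then have "32 * \<tau> ^ 3 - 2 * B * \<tau> \<le> 8 * \<tau> * (p (fst q))\<^sup>2 - 2 * B * \<tau>"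
        by (simp add: power2_eq_square power3_eq_cube)
      moreover have "(cmod (z (fst q) (snd q)))\<^sup>2 = exp (2 * \<tau> * \<phi> (fst q) (snd q)) * (cmod (w (fst q) (snd q)))\<^sup>2"
        by (simp add: z_def norm_mult power_mult_distrib e2)
      ultimately show "(32 * \<tau> ^ 3 - 2 * B * \<tau>) * (case q of (x, t) \<Rightarrow> exp (2 * \<tau> * \<phi> x t) * (cmod (w x t))\<^sup>2)
          \<le> (case q of (x, t) \<Rightarrow> (8 * \<tau> * (p x)\<^sup>2 - 2 * B * \<tau>) * (cmod (z x t))\<^sup>2)"
        unfolding case_prod_unfold by (simp only:) (rule mult_right_mono, auto)
    qed
    then have I1: "(32 * \<tau> ^ 3 - 2 * B * \<tau>) * E \<tau> \<le> I1"
      by (simp add: E_def)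
    \<comment> \<open>The flux bound with \<open>n = e^\<tau> m\<close>, as the weight is at most
      \<open>e^\<tau>\<close> where \<open>\<phi> \<le> 1\<close>.\<close>
    define C where "C = 12 * P ^ 3 * \<tau> ^ 3 * (exp \<tau> * m)\<^sup>2"
    have C: "C \<ge> 0"
      using P1 \<tau> by (simp add: C_def)
    have flux: "\<bar>carleman_flux_x \<tau> (p x) (g t) (z x t) (zx x t) (zt x t)\<bar> \<le> C"
      "\<bar>carleman_flux_t (p x) (g t) (z x t) (zx x t)\<bar> \<le> C"
      if xt: "(x, t) \<in> Q" and edge: "\<phi> x t \<le> 1" for x t
    proof -
      have ee: "e x t \<le> exp \<tau>"
        using edge \<tau> by (simp add: e_def)
      have "\<bar>p x\<bar> = 2 * (a + 1 - x) * \<tau>"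
        using xt \<tau> by (simp add: p_def abs_mult)
      also have "\<dots> \<le> 2 * (a + 1) * \<tau>"
        using xt \<tau> by (intro mult_right_mono) auto
      finally have p1: "\<bar>p x\<bar> \<le> 2 * (a + 1) * \<tau>" .
      have "\<bar>g t\<bar> = 2 * B * \<bar>t - t1\<bar> * \<tau>"
        using \<tau> B_nonneg by (simp add: g_def abs_mult)
      also have "\<dots> \<le> 2 * B * \<delta> * \<tau>"
        using xt \<tau> B_nonneg by (intro mult_right_mono mult_left_mono) (auto simp: abs_le_iff)
      finally have g1: "\<bar>g t\<bar> \<le> 2 * B * \<delta> * \<tau>" .
      have z1: "cmod (z x t) \<le> exp \<tau> * m"
        unfolding z_def norm_mult using ee e0[of x t] m xt by (intro mult_mono) auto
      have scale: "e x t * (m + q * m) \<le> P * \<tau> * (exp \<tau> * m)" if "0 \<le> q" "q \<le> r * \<tau>" "0 \<le> r" "1 + r \<le> P" for q r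
      proof -
        have "1 + q \<le> (1 + r) * \<tau>"
          using that \<tau> by (simp add: distrib_right)
        also have "\<dots> \<le> P * \<tau>"
          using that \<tau> by (intro mult_right_mono) auto
        finally have "e x t * ((1 + q) * m) \<le> exp \<tau> * (P * \<tau> * m)"
          using ee e0[of x t] m(1) P1 \<tau> that(1)
          by (intro mult_mono'[of "e x t" "exp \<tau>"] mult_right_mono) auto
        then show ?thesis
          by (simp add: algebra_simps)
      qed
      have "cmod (zx x t) \<le> e x t * (m + \<bar>p x\<bar> * m)"
        unfolding zx_def norm_mult using e0[of x t] m xt
        by (intro mult_mono order_trans[OF norm_triangle_ineq] add_mono) (auto simp: norm_mult intro!: mult_left_mono)
      also have "\<dots> \<le> P * \<tau> * (exp \<tau> * m)"
        using p1 P2(1) a by (rule_tac scale) auto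
      finally have z2: "cmod (zx x t) \<le> P * \<tau> * (exp \<tau> * m)" .
      have "cmod (zt x t) \<le> e x t * (m + \<bar>g t\<bar> * m)"
        unfolding zt_def norm_mult using e0[of x t] m xt
        by (intro mult_mono order_trans[OF norm_triangle_ineq] add_mono) (auto simp: norm_mult intro!: mult_left_mono)
      also have "\<dots> \<le> P * \<tau> * (exp \<tau> * m)"
        using g1 P2(2) B_nonneg \<delta> by (rule_tac scale) auto
      finally have z3: "cmod (zt x t) \<le> P * \<tau> * (exp \<tau> * m)" .
      have p2: "\<bar>p x\<bar> \<le> P * \<tau>" and g2: "\<bar>g t\<bar> \<le> P * \<tau>"
        using P2 \<tau> order_trans[OF p1 mult_right_mono[of "2 * (a + 1)" P \<tau>]]
          order_trans[OF g1 mult_right_mono[of "2 * B * \<delta>" P \<tau>]] by auto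
      show "\<bar>carleman_flux_x \<tau> (p x) (g t) (z x t) (zx x t) (zt x t)\<bar> \<le> C"
        "\<bar>carleman_flux_t (p x) (g t) (z x t) (zx x t)\<bar> \<le> C"
        unfolding C_def using carleman_flux_bounds[OF \<tau> P1 p2 g2 z1 z2 z3] by auto
    qed
    have "\<bar>I2\<bar> \<le> C * (t1 + \<delta> - (t1 - \<delta>))"
      unfolding I2_def using flux(1) \<phi>_edge(1) a \<delta> C by (intro integral_abs_bound) auto
    moreover have "\<bar>I3\<bar> \<le> 2 * C * (a - 0)"
      unfolding I3_def
    proof (intro integral_abs_bound)
      fix x assume "x \<in> {0..a}"
      then show "\<bar>carleman_flux_t (p x) (g (t1+\<delta>)) (z x (t1+\<delta>)) (zx x (t1+\<delta>))
                   - carleman_flux_t (p x) (g (t1-\<delta>)) (z x (t1-\<delta>)) (zx x (t1-\<delta>))\<bar> \<le> 2 * C"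
        using flux(2)[of x "t1+\<delta>"] flux(2)[of x "t1-\<delta>"] \<phi>_edge(2,3)[of x] \<delta> by auto
    qed (use a C in auto)
    ultimately have "- (I2 + I3) \<le> C * (2 * \<delta> + 2 * a)"
      by (simp add: algebra_simps)
    moreover have "C * (2 * \<delta> + 2 * a) = 12 * P ^ 3 * m\<^sup>2 * (2 * \<delta> + 2 * a) * \<tau> ^ 3 * exp (2 * \<tau>)"
      unfolding C_def power_mult_distrib exp_double by (simp only: mult_ac)
    moreover have "I1 + I2 + I3 \<le> M\<^sup>2 * E \<tau>"
      using est R by (simp only: L)
    moreover have "(32 * \<tau> ^ 3 - 2 * B * \<tau> - M\<^sup>2) * E \<tau> = (32 * \<tau> ^ 3 - 2 * B * \<tau>) * E \<tau> - M\<^sup>2 * E \<tau>"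
      by (simp add: algebra_simps)
    ultimately show ?thesis
      using I1 by linarith
  qed
  then show ?thesis by blast
qed

text \<open>By continuity \<open>|w|^2 > \<eta>\<close> and \<open>\<phi> > \<theta>\<close> on a
  small box around \<open>(x0, t1)\<close>, which alone contributes its area times
  \<open>\<eta> e^(2 \<tau> \<theta>)\<close>. The level \<open>\<theta>\<close> is midway between 1
  and \<open>\<phi> x0 t1 = (a + 1 - x0)^2 > 1\<close>.\<close>

lemma weighted_energy_ge:
  assumes "0 \<le> x0" "x0 < a" "w x0 t1 \<noteq> 0"
  shows "\<exists>V>0. \<exists>\<theta>>1. \<forall>\<tau>\<ge>0. V * exp (2 * \<tau> * \<theta>) \<le> E \<tau>"
proof -
  define q0 where "q0 = (x0, t1)"
  define \<eta> where "\<eta> = (cmod (w x0 t1))\<^sup>2 / 2"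
  define \<theta> where "\<theta> = (1 + \<phi> x0 t1) / 2"
  have \<eta>: "0 < \<eta>" "\<eta> < (cmod (w x0 t1))\<^sup>2"
    using assms by (auto simp: \<eta>_def)
  have "1\<^sup>2 < (a + 1 - x0)\<^sup>2"
    using assms by (intro power_strict_mono) auto
  then have \<theta>: "1 < \<theta>" "\<theta> < \<phi> x0 t1"
    by (auto simp: \<theta>_def \<phi>_def)
  \<comment> \<open>The Cauchy data exclude the edge \<open>x = 0\<close>, so the point is interior
    to \<open>Q\<close> and a full box fits around it.\<close>
  have "x0 \<noteq> 0"
    using assms zero(1)[of t1] \<delta> by auto
  then have q0: "q0 \<in> interior Q"
    using assms \<delta> by (simp add: q0_def interior_Times)
  have "continuous_on (interior Q) (\<lambda>q. (cmod (w (fst q) (snd q)))\<^sup>2)"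
    using continuous_on_case_prodD[OF cont(1)] interior_subset
    by (intro continuous_intros) (rule continuous_on_subset)
  then have "open (interior Q \<inter> (\<lambda>q. (cmod (w (fst q) (snd q)))\<^sup>2) -` {\<eta><..})"
    "open (interior Q \<inter> (\<lambda>q. \<phi> (fst q) (snd q)) -` {\<theta><..})"
    using cont_\<phi>[of "interior Q"] by (auto intro!: continuous_open_preimage)
  then have "open ((interior Q \<inter> (\<lambda>q. (cmod (w (fst q) (snd q)))\<^sup>2) -` {\<eta><..})
      \<inter> (interior Q \<inter> (\<lambda>q. \<phi> (fst q) (snd q)) -` {\<theta><..}))"
    by (rule open_Int)
  then obtain l u where lu: "q0 \<in> box l u"
    "cbox l u \<subseteq> (interior Q \<inter> (\<lambda>q. (cmod (w (fst q) (snd q)))\<^sup>2) -` {\<eta><..})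
      \<inter> (interior Q \<inter> (\<lambda>q. \<phi> (fst q) (snd q)) -` {\<theta><..})"
    using q0 \<eta> \<theta> by (elim open_contains_cbox[of _ q0]) (auto simp: q0_def)
  define V where "V = Henstock_Kurzweil_Integration.content (cbox l u) * \<eta>"
  have "V > 0"
    unfolding V_def using lu(1) \<eta>
    by (intro mult_pos_pos) (force simp: content_pos_lt_eq mem_box intro: less_trans)+
  moreover have "V * exp (2 * \<tau> * \<theta>) \<le> E \<tau>" if "\<tau> \<ge> 0" for \<tau>
  proof -
    let ?f = "\<lambda>(x, t). exp (2 * \<tau> * \<phi> x t) * (cmod (w x t))\<^sup>2"
    have sub: "cbox l u \<subseteq> Q"
      using lu(2) interior_subset by blast
    have cE: "continuous_on Q ?f"
      unfolding case_prod_unfold by (intro continuous_intros cont_\<phi> cont[THEN continuous_on_case_prodD])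
    have i: "?f integrable_on Q" "?f integrable_on cbox l u"
      using cE continuous_on_subset[OF cE sub] unfolding Q_box by (simp_all add: integrable_continuous)
    have "V * exp (2 * \<tau> * \<theta>) = integral (cbox l u) (\<lambda>_. exp (2 * \<tau> * \<theta>) * \<eta>)"
      by (simp add: V_def)
    also have "\<dots> \<le> integral (cbox l u) ?f"
    proof (rule integral_le)
      fix q assume "q \<in> cbox l u"
      then have "\<eta> < (cmod (w (fst q) (snd q)))\<^sup>2" "\<theta> < \<phi> (fst q) (snd q)"
        using lu(2) by auto
      then show "exp (2 * \<tau> * \<theta>) * \<eta> \<le> ?f q"
        using \<eta> that by (auto simp: case_prod_unfold intro!: mult_mono mult_left_mono)
    qed (use i in auto)
    also have "\<dots> \<le> E \<tau>"
      unfolding E_def by (rule integral_subset_le[OF sub i(2,1)]) auto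
    finally show ?thesis .
  qed
  ultimately show ?thesis
    using \<theta> by blast
qed

theorem vanishes:
  assumes "0 \<le> x0" "x0 < a"
  shows "w x0 t1 = 0"
proof (rule ccontr)
  assume "w x0 t1 \<noteq> 0"
  then obtain V \<theta> where V: "V > 0" "\<theta> > 1" "\<And>\<tau>. \<tau> \<ge> 0 \<Longrightarrow> V * exp (2 * \<tau> * \<theta>) \<le> E \<tau>"
    using weighted_energy_ge[OF assms] by blast
  obtain K where K: "\<And>\<tau>. \<tau> \<ge> 1 \<Longrightarrow> (32 * \<tau> ^ 3 - 2 * B * \<tau> - M\<^sup>2) * E \<tau> \<le> K * \<tau> ^ 3 * exp (2 * \<tau>)"
    using weighted_energy_le by blast
  \<comment> \<open>The entries 1, \<open>B\<close> and \<open>M^2\<close> ensure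
    \<open>32 \<tau>^3 - 2 B \<tau> - M^2 \<ge> \<tau>^3\<close>, so \<open>\<tau>^3\<close> cancels
    and \<open>V e^(2 \<tau> (\<theta> - 1)) \<le> K\<close> remains. The last entry contradicts
    this by \<open>e^y \<ge> 1 + y\<close>.\<close>
  define \<tau> where "\<tau> = Max {1, B, M\<^sup>2, K / (V * (\<theta> - 1))}"
  have \<tau>: "\<tau> \<ge> 1" "\<tau> \<ge> B" "\<tau> \<ge> M\<^sup>2" "\<tau> \<ge> K / (V * (\<theta> - 1))"
    by (auto simp: \<tau>_def)
  have E: "E \<tau> \<ge> 0"
    using V(3)[of \<tau>] V(1) \<tau>(1) by (smt (verit) exp_ge_zero mult_nonneg_nonneg)
  have "B * \<tau> \<le> \<tau>\<^sup>2" "\<tau>\<^sup>2 \<le> \<tau> ^ 3" "\<tau> \<le> \<tau> ^ 3"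
    using \<tau> power_increasing[of 2 3 \<tau>] power_increasing[of 1 3 \<tau>] by (auto simp: power2_eq_square mult_right_mono)
  then have "\<tau> ^ 3 \<le> 32 * \<tau> ^ 3 - 2 * B * \<tau> - M\<^sup>2"
    using \<tau> by linarith
  moreover from this have "0 \<le> 32 * \<tau> ^ 3 - 2 * B * \<tau> - M\<^sup>2"
    using \<tau>(1) zero_le_power[of \<tau> 3] by linarith
  ultimately have "\<tau> ^ 3 * (V * exp (2 * \<tau> * \<theta>)) \<le> (32 * \<tau> ^ 3 - 2 * B * \<tau> - M\<^sup>2) * E \<tau>"
    using V \<tau>(1) E by (intro mult_mono) (auto simp del: diff_ge_0_iff_ge)
  also have "\<dots> \<le> \<tau> ^ 3 * (K * exp (2 * \<tau>))"
    using K[OF \<tau>(1)] by (simp add: mult_ac)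
  finally have "V * exp (2 * \<tau> * \<theta>) \<le> K * exp (2 * \<tau>)"
    using \<tau>(1) by simp
  moreover have "exp (2 * \<tau> * \<theta>) = exp (2 * \<tau> * (\<theta> - 1)) * exp (2 * \<tau>)"
    by (simp add: algebra_simps flip: exp_add)
  ultimately have "V * exp (2 * \<tau> * (\<theta> - 1)) \<le> K"
    by simp
  moreover have "1 + 2 * \<tau> * (\<theta> - 1) \<le> exp (2 * \<tau> * (\<theta> - 1))"
    by (rule exp_ge_add_one_self)
  then have "V * (1 + 2 * \<tau> * (\<theta> - 1)) \<le> V * exp (2 * \<tau> * (\<theta> - 1))"
    using V(1) by (intro mult_left_mono) auto
  moreover have "K \<le> \<tau> * (V * (\<theta> - 1))"
    using \<tau>(4) V by (simp add: divide_le_eq)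
  moreover have "0 \<le> \<tau> * (V * (\<theta> - 1))"
    using \<tau>(1) V by simp
  moreover have "V * (1 + 2 * \<tau> * (\<theta> - 1)) = V + 2 * (\<tau> * (V * (\<theta> - 1)))"
    by (simp add: algebra_simps)
  ultimately show False
    using V(1) \<open>V * exp (2 * \<tau> * (\<theta> - 1)) \<le> K\<close> by linarith
qed

end

section \<open>Uniqueness for the Cauchy problem in the space variable\<close>

lemma pdx_has_vector_derivative:
  assumes "Cn_quarter (Suc n) u" "x \<ge> 0" "t \<ge> 0"
  shows "((\<lambda>y. u y t) has_vector_derivative pdx u x t) (at x within {0..})"
  using assms by (simp add: pdx_def deriv_half_def vector_derivative_works)

lemma pdt_has_vector_derivative:
  assumes "Cn_quarter (Suc n) u" "x \<ge> 0" "t \<ge> 0"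
  shows "((\<lambda>s. u x s) has_vector_derivative pdt u x t) (at t within {0..})"
  using assms by (simp add: pdt_def deriv_half_def vector_derivative_works)

lemma smooth_quarter_continuous:
  "smooth_quarter u \<Longrightarrow> continuous_on ({0..} \<times> {0..}) (\<lambda>(x, t). u x t)"
  by (metis Cn_quarter.simps(1) smooth_quarter_def)

lemma smooth_quarter_pdx: "smooth_quarter u \<Longrightarrow> smooth_quarter (pdx u)"
  and smooth_quarter_pdt: "smooth_quarter u \<Longrightarrow> smooth_quarter (pdt u)"
  by (metis Cn_quarter.simps(2) smooth_quarter_def)+

lemma at_within_atLeast_eq: 
  fixes t :: real
  shows "at t within {a..t+1} = at t within {a..}"
  by (rule at_within_nhd[of _ "{..<t+1}"]) auto

lemma at_within_atLeast_neq_bot: "a \<le> x \<Longrightarrow> at x within {a::real..} \<noteq> bot"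
  using trivial_limit_at_right_real[of x] at_le[of "{x<..}" "{a..}" x]
  by (metis Ioi_le_Ico bot.extremum_uniqueI greaterThan_subset_iff order_trans)

text \<open>Symmetry of mixed derivatives up to the boundary. Differentiating
  \<open>u(x,s) - u(x,0)\<close>, the integral of \<open>pdt u\<close>, under the integral sign in
  \<open>x\<close> writes \<open>pdx u x s\<close> as a constant plus the integral of
  \<open>pdx (pdt u)\<close>; then differentiate in \<open>s\<close>.\<close>

lemma pdx_pdt_commute:
  assumes "smooth_quarter u" "x \<ge> 0" "t \<ge> 0"
  shows "((\<lambda>s. pdx u x s) has_vector_derivative pdx (pdt u) x t) (at t within {0..})"
proof -
  let ?D = "pdx (pdt u)"
  have C: "Cn_quarter (Suc 0) u" "Cn_quarter (Suc 0) (pdt u)"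
    using assms(1) smooth_quarter_pdt[OF assms(1)] unfolding smooth_quarter_def by blast+
  have cD: "continuous_on ({0..} \<times> {0..}) (\<lambda>(x, t). ?D x t)"
    and cT: "continuous_on ({0..} \<times> {0..}) (\<lambda>(x, t). pdt u x t)"
    using assms by (simp_all add: smooth_quarter_continuous smooth_quarter_pdx smooth_quarter_pdt)
  have slice: "continuous_on {0..s} (f x)" if "continuous_on ({0..} \<times> {0..}) (\<lambda>(x, t). f x t)" "x \<ge> 0"
    for f :: "real \<Rightarrow> real \<Rightarrow> complex" and x s
  proof -
    have "continuous_on {0..s} (\<lambda>t. (\<lambda>(x, t). f x t) (x, t))"
      by (rule continuous_on_compose2[OF that(1)]) (use that(2) in \<open>auto intro!: continuous_intros\<close>)
    then show ?thesis by simp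
  qed
  have eq: "pdx u x s = pdx u x 0 + integral {0..s} (?D x)" if s: "s \<ge> 0" for s
  proof -
    have ftc: "integral {0..s} (pdt u y) = u y s - u y 0" if "y \<in> {0..}" for y
    proof (intro integral_unique fundamental_theorem_of_calculus s)
      fix r assume "r \<in> {0..s}"
      then show "(u y has_vector_derivative pdt u y r) (at r within {0..s})"
        using that by (intro has_vector_derivative_within_subset[OF pdt_has_vector_derivative[OF C(1)]]) auto
    qed
    have "((\<lambda>y. integral (cbox 0 s) (pdt u y)) has_vector_derivative integral (cbox 0 s) (?D x))
        (at x within {0..})"
    proof (rule leibniz_rule_vector_derivative)
      fix y r :: real assume "y \<in> {0..}" "r \<in> cbox 0 s"
      then show "((\<lambda>y. pdt u y r) has_vector_derivative ?D y r) (at y within {0..})"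
        using pdx_has_vector_derivative[OF C(2)] by (simp add: box_real)
    next
      fix y :: real assume "y \<in> {0..}"
      then show "pdt u y integrable_on cbox 0 s"
        using slice[OF cT] by (simp add: box_real integrable_continuous_real)
    next
      show "continuous_on ({0..} \<times> cbox 0 s) (\<lambda>(y, r). ?D y r)"
        by (rule continuous_on_subset[OF cD]) (auto simp: box_real)
    qed (use assms(2) in auto)
    then have "((\<lambda>y. u y s - u y 0) has_vector_derivative integral {0..s} (?D x)) (at x within {0..})"
      unfolding box_real
      by (rule has_vector_derivative_transform[rotated 2]) (use assms(2) ftc in auto)
    moreover have "((\<lambda>y. u y s - u y 0) has_vector_derivative pdx u x s - pdx u x 0) (at x within {0..})"
      using assms s by (intro has_vector_derivative_diff pdx_has_vector_derivative[OF C(1)]) auto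
    ultimately have "integral {0..s} (?D x) = pdx u x s - pdx u x 0"
      by (rule vector_derivative_unique_within[OF at_within_atLeast_neq_bot[OF assms(2)]])
    then show ?thesis by simp
  qed
  have "((\<lambda>s. pdx u x 0 + integral {0..s} (?D x)) has_vector_derivative 0 + ?D x t) (at t within {0..t+1})"
    using assms slice[OF cD]
    by (intro has_vector_derivative_add has_vector_derivative_const integral_has_vector_derivative) auto
  then show ?thesis
    unfolding at_within_atLeast_eq add_0
    by (rule has_vector_derivative_transform[rotated 2]) (use assms(3) in \<open>auto intro: eq\<close>)
qed

text \<open>The derivatives are parameters, so that a shifted and rotated solution is again an
  instance with shifted and rotated derivatives. The equation is required on the closed strip,
  including \<open>x = 0\<close> and \<open>t = t0\<close>.\<close>

locale nls_strip =
  fixes t0 :: real and u ux ut uxx uxt :: "real \<Rightarrow> real \<Rightarrow> complex"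
  assumes cont: "continuous_on ({0..} \<times> {t0..}) (\<lambda>(x, t). u x t)"
      "continuous_on ({0..} \<times> {t0..}) (\<lambda>(x, t). ux x t)"
      "continuous_on ({0..} \<times> {t0..}) (\<lambda>(x, t). ut x t)"
      "continuous_on ({0..} \<times> {t0..}) (\<lambda>(x, t). uxx x t)"
      "continuous_on ({0..} \<times> {t0..}) (\<lambda>(x, t). uxt x t)"
    and deriv: "\<And>x t. x \<ge> 0 \<Longrightarrow> t \<ge> t0 \<Longrightarrow> ((\<lambda>x. u x t) has_vector_derivative ux x t) (at x within {0..})"
      "\<And>x t. x \<ge> 0 \<Longrightarrow> t \<ge> t0 \<Longrightarrow> ((\<lambda>x. ux x t) has_vector_derivative uxx x t) (at x within {0..})"
      "\<And>x t. x \<ge> 0 \<Longrightarrow> t \<ge> t0 \<Longrightarrow> ((\<lambda>x. ut x t) has_vector_derivative uxt x t) (at x within {0..})"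
      "\<And>x t. x \<ge> 0 \<Longrightarrow> t \<ge> t0 \<Longrightarrow> ((\<lambda>t. u x t) has_vector_derivative ut x t) (at t within {t0..})"
      "\<And>x t. x \<ge> 0 \<Longrightarrow> t \<ge> t0 \<Longrightarrow> ((\<lambda>t. ux x t) has_vector_derivative uxt x t) (at t within {t0..})"
    and nls: "\<And>x t. x \<ge> 0 \<Longrightarrow> t \<ge> t0 \<Longrightarrow>
        \<i> * ut x t + uxx x t = 2 * of_real ((cmod (u x t))\<^sup>2) * u x t"

text \<open>Since \<open>t0 > 0\<close>, the strip lies in \<open>t > 0\<close>, where the equation
  holds for \<open>x > 0\<close>; it extends to \<open>x = 0\<close> by continuity of both
  sides.\<close>

lemma nls_quarter_solution_strip:
  assumes "nls_quarter_solution u" "t0 > 0"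
  shows "nls_strip t0 u (pdx u) (pdt u) (pdx (pdx u)) (pdx (pdt u))"
proof -
  have sm: "smooth_quarter u"
    using assms by (simp add: nls_quarter_solution_def)
  note sm' = sm smooth_quarter_pdx[OF sm] smooth_quarter_pdt[OF sm]
    smooth_quarter_pdx[OF smooth_quarter_pdx[OF sm]] smooth_quarter_pdx[OF smooth_quarter_pdt[OF sm]]
  have C: "Cn_quarter (Suc 0) u" "Cn_quarter (Suc 0) (pdx u)" "Cn_quarter (Suc 0) (pdt u)"
    using sm' unfolding smooth_quarter_def by blast+
  have sub: "{0..} \<times> {t0..} \<subseteq> {0::real..} \<times> {0..}"
    using assms(2) by auto
  note c = continuous_on_subset[OF smooth_quarter_continuous sub]
  show ?thesis
  proof
    fix x t :: real assume xt: "x \<ge> 0" "t \<ge> t0"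
    then have t: "t > 0" "t \<ge> 0"
      using assms(2) by auto
    show "((\<lambda>x. u x t) has_vector_derivative pdx u x t) (at x within {0..})"
      "((\<lambda>x. pdx u x t) has_vector_derivative pdx (pdx u) x t) (at x within {0..})"
      "((\<lambda>x. pdt u x t) has_vector_derivative pdx (pdt u) x t) (at x within {0..})"
      using C pdx_has_vector_derivative xt t by blast+
    show "((\<lambda>t. u x t) has_vector_derivative pdt u x t) (at t within {t0..})"
      "((\<lambda>t. pdx u x t) has_vector_derivative pdx (pdt u) x t) (at t within {t0..})"
      using pdt_has_vector_derivative[OF C(1) xt(1) t(2)] pdx_pdt_commute[OF sm xt(1) t(2)] assms(2)
      by (auto intro: has_vector_derivative_within_subset)
    let ?F = "\<lambda>x. \<i> * pdt u x t + pdx (pdx u) x t - 2 * of_real ((cmod (u x t))\<^sup>2) * u x t"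
    have slice: "continuous_on {0..} (\<lambda>x. f x t)" if "smooth_quarter f" for f :: "real \<Rightarrow> real \<Rightarrow> complex"
      using continuous_on_compose2[OF smooth_quarter_continuous[OF that], of "{0..}" "\<lambda>x. (x, t)"] t
      by (force intro!: continuous_intros)
    have "continuous_on {0..} ?F"
      using sm' by (intro continuous_intros slice)
    then have "continuous_on (closure {0<..}) ?F"
      by simp
    moreover have "?F x = 0" if "x \<in> {0<..}" for x
      using assms t that by (simp add: nls_quarter_solution_def)
    ultimately have "?F x = 0"
      using continuous_constant_on_closure[of "{0<..}" ?F 0 x] xt by simp
    then show "\<i> * pdt u x t + pdx (pdx u) x t = 2 * of_real ((cmod (u x t))\<^sup>2) * u x t"
      by simp
  qed (use sm' c in auto)
qed

text \<open>Split \<open>|v|^2 v - |u|^2 u\<close> as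
  \<open>|v|^2 (v - u) + (|v|^2 - |u|^2) u\<close>. The two parts cost \<open>K^2\<close> and
  \<open>2 K^2\<close> times \<open>|v - u|\<close>, and the factor 2 of the equation makes
  6.\<close>

lemma cubic_lipschitz:
  assumes "cmod v \<le> K" "cmod u \<le> K"
  shows "cmod (2 * of_real ((cmod v)\<^sup>2) * v - 2 * of_real ((cmod u)\<^sup>2) * u) \<le> 6 * K\<^sup>2 * cmod (v - u)"
proof -
  have K: "K \<ge> 0"
    using assms(1) norm_ge_zero order_trans by blast
  have "\<bar>(cmod v)\<^sup>2 - (cmod u)\<^sup>2\<bar> = \<bar>cmod v - cmod u\<bar> * (cmod v + cmod u)"
    by (simp add: power2_eq_square square_diff_square_factored abs_mult mult.commute)
  also have "\<dots> \<le> cmod (v - u) * (K + K)"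
    using assms K by (intro mult_mono norm_triangle_ineq3 add_mono) auto
  finally have d: "\<bar>(cmod v)\<^sup>2 - (cmod u)\<^sup>2\<bar> \<le> cmod (v - u) * (2 * K)"
    by simp
  have "2 * of_real ((cmod v)\<^sup>2) * v - 2 * of_real ((cmod u)\<^sup>2) * u
      = 2 * (of_real ((cmod v)\<^sup>2) * (v - u) + of_real ((cmod v)\<^sup>2 - (cmod u)\<^sup>2) * u)"
    by (simp add: algebra_simps)
  also have "cmod \<dots> \<le> 2 * ((cmod v)\<^sup>2 * cmod (v - u) + \<bar>(cmod v)\<^sup>2 - (cmod u)\<^sup>2\<bar> * cmod u)"
    unfolding norm_mult using norm_triangle_ineq[of "of_real ((cmod v)\<^sup>2) * (v - u)" "of_real ((cmod v)\<^sup>2 - (cmod u)\<^sup>2) * u"]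
    by (simp add: norm_mult del: of_real_diff of_real_power)
  also have "\<dots> \<le> 2 * (K\<^sup>2 * cmod (v - u) + (cmod (v - u) * (2 * K)) * K)"
    using assms K d by (intro mult_left_mono add_mono mult_mono power_mono) auto
  also have "\<dots> = 6 * K\<^sup>2 * cmod (v - u)"
    by (simp add: power2_eq_square algebra_simps)
  finally show ?thesis .
qed

lemma nls_strip_bounded:
  assumes "nls_strip t0 u ux ut uxx uxt" "c \<ge> t0"
  shows "\<exists>K. \<forall>x\<in>{0..a}. \<forall>t\<in>{c..d}. cmod (u x t) \<le> K"
proof -
  interpret nls_strip t0 u ux ut uxx uxt by fact
  have "compact ({0..a} \<times> {c..d})"
    by (intro compact_Times) auto
  moreover have "continuous_on ({0..a} \<times> {c..d}) (\<lambda>(x, t). u x t)"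
    using assms(2) by (intro continuous_on_subset[OF cont(1)]) auto
  ultimately have "bounded ((\<lambda>(x, t). u x t) ` ({0..a} \<times> {c..d}))"
    using compact_continuous_image compact_imp_bounded by blast
  then show ?thesis
    unfolding bounded_iff by fastforce
qed

text \<open>On a compact rectangle both solutions are bounded by some \<open>K\<close>, so their
  difference satisfies a linear differential inequality with \<open>M = 6 K^2\<close> and has zero
  Cauchy data; unique continuation applies. \<open>K\<close> may depend on the rectangle.\<close>

theorem nls_cauchy_unique:
  assumes u: "nls_strip t0 u ux ut uxx uxt" and v: "nls_strip t0 v vx vt vxx vxt"
    and data: "\<And>t. t \<ge> t0 \<Longrightarrow> v 0 t = u 0 t" "\<And>t. t \<ge> t0 \<Longrightarrow> vx 0 t = ux 0 t"
    and xt: "x0 \<ge> 0" "t1 > t0"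
  shows "v x0 t1 = u x0 t1"
proof -
  interpret u: nls_strip t0 u ux ut uxx uxt by fact
  interpret v: nls_strip t0 v vx vt vxx vxt by fact
  \<comment> \<open>The choice gives \<open>x0 < a\<close>, and the time window centred at
    \<open>t1\<close> begins exactly at \<open>t0\<close>; its half-width is positive because
    \<open>t1 > t0\<close>.\<close>
  define a \<delta> where "a = x0 + 1" and "\<delta> = t1 - t0"
  have t0: "t1 - \<delta> = t0"
    by (simp add: \<delta>_def)
  obtain Ku Kv where Ku: "\<And>x t. x \<in> {0..a} \<Longrightarrow> t \<in> {t0..t1+\<delta>} \<Longrightarrow> cmod (u x t) \<le> Ku"
    and Kv: "\<And>x t. x \<in> {0..a} \<Longrightarrow> t \<in> {t0..t1+\<delta>} \<Longrightarrow> cmod (v x t) \<le> Kv"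
    using nls_strip_bounded[OF u order_refl, of a "t1+\<delta>"] nls_strip_bounded[OF v order_refl, of a "t1+\<delta>"] by metis
  define K where "K = max Ku Kv"
  have sub: "{0..a} \<times> {t0..t1+\<delta>} \<subseteq> {0..} \<times> {t0..}"
    by auto
  note cont = u.cont[THEN continuous_on_subset[OF _ sub]] v.cont[THEN continuous_on_subset[OF _ sub]]
  interpret vanishing_cauchy_data "\<lambda>x t. v x t - u x t" "\<lambda>x t. vx x t - ux x t" "\<lambda>x t. vt x t - ut x t"
    "\<lambda>x t. vxx x t - uxx x t" "\<lambda>x t. vxt x t - uxt x t" a t1 \<delta> "6 * K\<^sup>2"
  proof (unfold_locales, unfold t0)
    show "a > 0" "\<delta> > 0"
      using xt by (auto simp: a_def \<delta>_def)
  next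
    fix x t assume h: "x \<in> {0..a}" "t \<in> {t0..t1+\<delta>}"
    have h': "x \<ge> 0" "t \<ge> t0" using h by auto
    note du = u.deriv[OF h'] and dv = v.deriv[OF h']
    have sx: "{0..a} \<subseteq> {0..}" "{t0..t1+\<delta>} \<subseteq> {t0..}" by auto
    note w = has_vector_derivative_within_subset
    show "((\<lambda>x. v x t - u x t) has_vector_derivative vx x t - ux x t) (at x within {0..a})"
      "((\<lambda>x. vx x t - ux x t) has_vector_derivative vxx x t - uxx x t) (at x within {0..a})"
      "((\<lambda>x. vt x t - ut x t) has_vector_derivative vxt x t - uxt x t) (at x within {0..a})"
      "((\<lambda>t. v x t - u x t) has_vector_derivative vt x t - ut x t) (at t within {t0..t1+\<delta>})"
      "((\<lambda>t. vx x t - ux x t) has_vector_derivative vxt x t - uxt x t) (at t within {t0..t1+\<delta>})"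
      by (intro has_vector_derivative_diff w[OF du(1) sx(1)] w[OF dv(1) sx(1)] w[OF du(2) sx(1)]
          w[OF dv(2) sx(1)] w[OF du(3) sx(1)] w[OF dv(3) sx(1)] w[OF du(4) sx(2)] w[OF dv(4) sx(2)]
          w[OF du(5) sx(2)] w[OF dv(5) sx(2)])+
    have "\<i> * (vt x t - ut x t) + (vxx x t - uxx x t)
        = 2 * of_real ((cmod (v x t))\<^sup>2) * v x t - 2 * of_real ((cmod (u x t))\<^sup>2) * u x t"
      unfolding u.nls[OF h', symmetric] v.nls[OF h', symmetric] by (simp add: algebra_simps)
    then show "cmod (\<i> * (vt x t - ut x t) + (vxx x t - uxx x t)) \<le> 6 * K\<^sup>2 * cmod (v x t - u x t)"
      using cubic_lipschitz[of "v x t" K "u x t"] Ku[OF h] Kv[OF h] by (simp add: K_def)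
  next
    fix t assume "t \<in> {t0..t1+\<delta>}"
    then show "v 0 t - u 0 t = 0" "vx 0 t - ux 0 t = 0"
      using data by auto
  qed (use cont in \<open>auto simp: case_prod_unfold intro!: continuous_intros\<close>)
  show ?thesis
    using vanishes[of x0] xt by (simp add: a_def)
qed

section \<open>Decaying stationary profiles\<close>

lemma half_line_mono:
  fixes f f' :: "real \<Rightarrow> real"
  assumes "\<And>x. x \<ge> 0 \<Longrightarrow> (f has_real_derivative f' x) (at x within {0..})"
    and "\<And>x. x \<ge> 0 \<Longrightarrow> f' x \<ge> 0" "0 \<le> x" "x \<le> y"
  shows "f x \<le> f y"
proof (rule DERIV_nonneg_imp_increasing_open[OF assms(4)])
  fix z assume z: "x < z" "z < y"
  have "at z within {0..} = at z"
    using z assms(3) by (intro at_within_interior) (auto simp: interior_real_atLeast)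
  then show "\<exists>l. (f has_real_derivative l) (at z) \<and> 0 \<le> l"
    using assms(1,2)[of z] assms(3) z by auto
next
  have "continuous_on {0..} f"
    using assms(1) by (intro DERIV_continuous_on) auto
  then show "continuous_on {x..y} f"
    by (rule continuous_on_subset) (use assms(3) in auto)
qed

lemma half_line_constant_zero:
  fixes f :: "real \<Rightarrow> real"
  assumes "\<And>x. x \<ge> 0 \<Longrightarrow> (f has_real_derivative 0) (at x within {0..})"
    and "(f \<longlongrightarrow> 0) at_top" "x \<ge> 0"
  shows "f x = 0"
proof -
  have "\<exists>c. \<forall>y\<in>{0..}. f y = c"
    using assms(1) by (intro has_field_derivative_zero_constant) auto
  then obtain c where c: "\<And>y. y \<ge> 0 \<Longrightarrow> f y = c"
    by auto
  have "((\<lambda>_::real. c) \<longlongrightarrow> 0) at_top"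
    by (rule Lim_transform_eventually[OF assms(2)]) (use c in \<open>auto intro: eventually_at_top_linorderI[of 0]\<close>)
  then have "c = 0"
    by (simp add: tendsto_const_iff)
  then show ?thesis
    using c assms(3) by simp
qed

lemma tendsto_zero_of_weighted_bound:
  fixes f :: "real \<Rightarrow> complex"
  assumes "\<And>x. x \<ge> 0 \<Longrightarrow> cmod (of_real x * f x) \<le> C"
  shows "(f \<longlongrightarrow> 0) at_top"
proof (rule Lim_null_comparison)
  show "eventually (\<lambda>x. cmod (f x) \<le> C / x) at_top"
    using eventually_gt_at_top[of 0]
    by eventually_elim (use assms in \<open>auto simp: norm_mult field_simps\<close>)
  show "((\<lambda>x. C / x) \<longlongrightarrow> 0) at_top"
    by (rule real_tendsto_divide_at_top[OF tendsto_const filterlim_ident])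
qed

text \<open>The stationary equation with a finite amount of Schwartz decay: the weight
  \<open>x\<close> yields the limits at infinity, while \<open>x^2\<close> contradicts the decay of
  order \<open>1 / x\<close> that \<open>\<omega> = 0\<close> would allow.\<close>

locale decaying_profile =
  fixes U V :: "real \<Rightarrow> complex" and \<omega> C :: real
  assumes dU: "\<And>x. x \<ge> 0 \<Longrightarrow> (U has_vector_derivative V x) (at x within {0..})"
    and dV: "\<And>x. x \<ge> 0 \<Longrightarrow>
      (V has_vector_derivative of_real (\<omega> + 2 * (cmod (U x))\<^sup>2) * U x) (at x within {0..})"
    and bounds: "\<And>x. x \<ge> 0 \<Longrightarrow> cmod (of_real x * U x) \<le> C"
      "\<And>x. x \<ge> 0 \<Longrightarrow> cmod (of_real x * V x) \<le> C"
      "\<And>x. x \<ge> 0 \<Longrightarrow> cmod (of_real (x\<^sup>2) * U x) \<le> C"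
begin

text \<open>These four real quantities are invariant under a constant rotation of \<open>U\<close>
  and \<open>V\<close> and obey a closed system, so the phase of \<open>U\<close> never has to be
  followed.\<close>

definition "m x = (cmod (U x))\<^sup>2"
definition "n x = (cmod (V x))\<^sup>2"
definition "k x = Re (V x * cnj (U x))"
definition "J x = Im (V x * cnj (U x))"

lemma derivs:
  assumes "x \<ge> 0"
  shows "(m has_real_derivative 2 * k x) (at x within {0..})"
    and "(n has_real_derivative 2 * (\<omega> + 2 * m x) * k x) (at x within {0..})"
    and "(k has_real_derivative n x + (\<omega> + 2 * m x) * m x) (at x within {0..})"
    and "(J has_real_derivative 0) (at x within {0..})"
proof -
  note d = has_real_derivative_Re_Im[OF dU[OF assms]] has_real_derivative_Re_Im[OF dV[OF assms]]
  show "(m has_real_derivative 2 * k x) (at x within {0..})"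
    unfolding m_def[abs_def] k_def cmod_power2 times_complex.sel cnj.sel
    by (rule d derivative_eq_intros refl)+ (simp add: algebra_simps)
  show "(n has_real_derivative 2 * (\<omega> + 2 * m x) * k x) (at x within {0..})"
    unfolding n_def[abs_def] k_def cmod_power2 times_complex.sel cnj.sel
    by (rule d derivative_eq_intros refl)+ (simp add: m_def cmod_power2 algebra_simps)
  show "(k has_real_derivative n x + (\<omega> + 2 * m x) * m x) (at x within {0..})"
    unfolding n_def k_def[abs_def] m_def cmod_power2 times_complex.sel cnj.sel
    by (rule d derivative_eq_intros refl)+ (simp add: cmod_power2, simp add: algebra_simps power2_eq_square)
  show "(J has_real_derivative 0) (at x within {0..})"
    unfolding J_def[abs_def] times_complex.sel cnj.sel
    by (rule d derivative_eq_intros refl)+ (simp add: algebra_simps)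
qed

lemma limits:
  shows "(m \<longlongrightarrow> 0) at_top" "(n \<longlongrightarrow> 0) at_top" "(k \<longlongrightarrow> 0) at_top" "(J \<longlongrightarrow> 0) at_top"
proof -
  have U: "(U \<longlongrightarrow> 0) at_top" and V: "(V \<longlongrightarrow> 0) at_top"
    by (rule tendsto_zero_of_weighted_bound, rule bounds, assumption)+
  show "(m \<longlongrightarrow> 0) at_top" "(n \<longlongrightarrow> 0) at_top"
    using tendsto_power[OF tendsto_norm[OF U], of 2] tendsto_power[OF tendsto_norm[OF V], of 2]
    by (simp_all add: m_def[abs_def] n_def[abs_def])
  have "((\<lambda>x. V x * cnj (U x)) \<longlongrightarrow> 0) at_top"
    using tendsto_mult[OF V tendsto_cnj[OF U]] by simp
  from tendsto_Re[OF this] tendsto_Im[OF this]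
  show "(k \<longlongrightarrow> 0) at_top" "(J \<longlongrightarrow> 0) at_top"
    by (simp_all add: k_def[abs_def] J_def[abs_def])
qed

lemma momentum_zero: "x \<ge> 0 \<Longrightarrow> J x = 0"
  by (rule half_line_constant_zero[OF derivs(4) limits(4)])

lemma energy_zero:
  assumes "x \<ge> 0"
  shows "n x = m x * (\<omega> + m x)"
proof -
  have "n x - \<omega> * m x - (m x)\<^sup>2 = 0"
  proof (rule half_line_constant_zero[OF _ _ assms])
    fix y :: real assume y: "y \<ge> 0"
    show "((\<lambda>x. n x - \<omega> * m x - (m x)\<^sup>2) has_real_derivative 0) (at y within {0..})"
      by (rule derivs[OF y] derivative_eq_intros refl)+ (simp add: algebra_simps)
  next
    show "((\<lambda>x. n x - \<omega> * m x - (m x)\<^sup>2) \<longlongrightarrow> 0) at_top"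
      using tendsto_diff[OF tendsto_diff[OF limits(2) tendsto_mult_left[OF limits(1)]] tendsto_power[OF limits(1)], of \<omega> 2]
      by simp
  qed
  then show ?thesis
    by (simp add: power2_eq_square algebra_simps)
qed

lemma m_nonneg: "m x \<ge> 0" and n_nonneg: "n x \<ge> 0"
  by (simp_all add: m_def n_def)

text \<open>If \<open>\<omega> < 0\<close>, zero energy gives \<open>m 0 \<ge> - \<omega>\<close>,
  whereas \<open>m\<close> tends to 0. At an intermediate point \<open>m = - \<omega> / 2\<close>,
  and there the energy relation would make \<open>n\<close> negative.\<close>

lemma omega_nonneg:
  assumes "m 0 > 0"
  shows "\<omega> \<ge> 0"
proof (rule ccontr)
  assume \<omega>: "\<not> \<omega> \<ge> 0"
  have "0 \<le> m 0 * (\<omega> + m 0)"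
    using energy_zero[of 0] n_nonneg[of 0] by simp
  then have m0: "m 0 \<ge> - \<omega>"
    using assms by (simp add: zero_le_mult_iff)
  have "eventually (\<lambda>x. m x < - \<omega> / 2) at_top"
    using order_tendstoD(2)[OF limits(1), of "- \<omega> / 2"] \<omega> by simp
  from eventually_conj[OF this eventually_ge_at_top[of 0]]
  obtain X where X: "X \<ge> 0" "m X < - \<omega> / 2"
    by (auto simp: eventually_at_top_linorder)
  have "continuous_on {0..} m"
    using derivs(1) by (intro DERIV_continuous_on) auto
  then have "continuous_on {0..X} m"
    by (rule continuous_on_subset) auto
  then obtain x where x: "0 \<le> x" "m x = - \<omega> / 2"
    using IVT2'[of m X "- \<omega> / 2" 0] X m0 \<omega> by auto
  have "0 \<le> (- \<omega> / 2) * (\<omega> + - \<omega> / 2)"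
    using energy_zero[OF x(1)] n_nonneg[of x] x(2) by simp
  then show False
    using \<omega> by (simp add: zero_le_mult_iff mult_le_0_iff)
qed

text \<open>For \<open>\<omega> \<ge> 0\<close> the derivative of \<open>k\<close> is nonnegative,
  so \<open>k\<close> increases towards its limit 0.\<close>

lemma k_nonpos:
  assumes "\<omega> \<ge> 0" "x \<ge> 0"
  shows "k x \<le> 0"
proof (rule tendsto_lowerbound[OF limits(3)])
  show "eventually (\<lambda>y. k x \<le> k y) at_top"
    using eventually_ge_at_top[of x]
    by eventually_elim
       (use assms m_nonneg n_nonneg in \<open>auto intro!: half_line_mono[OF derivs(3)]\<close>)
qed auto

text \<open>For \<open>\<omega> = 0\<close> zero energy reads \<open>|V| = |U|^2\<close>, so
  \<open>1 / |U|\<close> grows with slope at most 1. Then \<open>|U|\<close> is at least of order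
  \<open>1 / x\<close>, against the \<open>x^2\<close> bound.\<close>

lemma omega_nonzero:
  assumes "m 0 > 0"
  shows "\<omega> \<noteq> 0"
proof
  assume \<omega>: "\<omega> = 0"
  define \<alpha> where "\<alpha> = cmod (U 0)"
  have \<alpha>: "\<alpha> > 0"
    using assms by (simp add: \<alpha>_def m_def)
  have k_abs: "\<bar>k x\<bar> \<le> m x * cmod (U x)" if "x \<ge> 0" for x
  proof -
    have "(cmod (V x))\<^sup>2 = ((cmod (U x))\<^sup>2)\<^sup>2"
      using energy_zero[OF that] by (simp add: \<omega> n_def m_def power2_eq_square)
    then have "cmod (V x) = (cmod (U x))\<^sup>2"
      by (rule power2_eq_imp_eq) auto
    then show ?thesis
      using abs_Re_le_cmod[of "V x * cnj (U x)"] by (simp add: k_def m_def norm_mult)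
  qed
  have m_decr: "m x \<le> m 0" if "x \<ge> 0" for x
    using half_line_mono[of "\<lambda>x. - m x" "\<lambda>x. - (2 * k x)" 0 x] that k_nonpos \<omega>
    by (auto intro!: derivative_intros derivs)
  have U_le: "cmod (U x) \<le> \<alpha>" if "x \<ge> 0" for x
    using m_decr[OF that] by (simp add: m_def \<alpha>_def)
  \<comment> \<open>From \<open>m' = 2 k \<ge> - 2 \<alpha> m\<close> the function
    \<open>m e^(2 \<alpha> x)\<close> is nondecreasing. Thus \<open>U\<close> has no zero and
    \<open>1 / |U|\<close> can be differentiated.\<close>
  have m_pos: "m x > 0" if "x \<ge> 0" for x
  proof -
    have "m 0 * exp (2 * \<alpha> * 0) \<le> m x * exp (2 * \<alpha> * x)"
    proof (rule half_line_mono[where f = "\<lambda>x. m x * exp (2 * \<alpha> * x)" and f' = "\<lambda>x. (2 * k x + 2 * \<alpha> * m x) * exp (2 * \<alpha> * x)"])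
      fix y :: real assume y: "y \<ge> 0"
      show "((\<lambda>x. m x * exp (2 * \<alpha> * x)) has_real_derivative
              (2 * k y + 2 * \<alpha> * m y) * exp (2 * \<alpha> * y)) (at y within {0..})"
        by (rule derivs[OF y] derivative_eq_intros refl)+ (simp add: algebra_simps)
      have "m y * cmod (U y) \<le> m y * \<alpha>"
        using U_le[OF y] m_nonneg by (intro mult_left_mono) auto
      then have "0 \<le> 2 * k y + 2 * \<alpha> * m y"
        using k_abs[OF y] by (simp add: algebra_simps abs_le_iff)
      then show "0 \<le> (2 * k y + 2 * \<alpha> * m y) * exp (2 * \<alpha> * y)"
        by simp
    qed (use that in auto)
    then have "0 < m x * exp (2 * \<alpha> * x)"
      using assms by simp
    then show ?thesis
      by (simp add: zero_less_mult_iff)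
  qed
  have lower: "1 / cmod (U x) \<le> 1 / \<alpha> + x" if "x \<ge> 0" for x
  proof -
    have "0 - 1 / cmod (U 0) \<le> x - 1 / cmod (U x)"
    proof (rule half_line_mono[where f = "\<lambda>x. x - 1 / cmod (U x)" and f' = "\<lambda>x. 1 + k x / (m x * cmod (U x))"])
      fix y :: real assume y: "y \<ge> 0"
      have U0: "cmod (U y) > 0"
        using m_pos[OF y] by (simp add: m_def)
      have "((\<lambda>x. x - 1 / sqrt (m x)) has_real_derivative 1 + k y / (m y * sqrt (m y))) (at y within {0..})"
        unfolding divide_inverse mult_1_left
      proof -
        have "((\<lambda>x. sqrt (m x)) has_real_derivative inverse (sqrt (m y)) / 2 * (2 * k y)) (at y within {0..})"
          by (rule DERIV_chain2[OF DERIV_real_sqrt[OF m_pos[OF y]] derivs(1)[OF y]])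
        note D = DERIV_diff[OF DERIV_ident DERIV_inverse_fun[OF this]]
        have key: "1 - - (inverse r / 2 * (2 * q) * inverse (r ^ Suc (Suc 0))) = 1 + q * inverse ((r * r) * r)"
          if "r \<noteq> 0" for r q :: real
          using that by (simp add: field_simps)
        have r: "sqrt (m y) \<noteq> 0" "sqrt (m y) * sqrt (m y) = m y"
          using m_pos[OF y] by simp_all
        show "((\<lambda>x. x - inverse (sqrt (m x))) has_real_derivative 1 + k y * inverse (m y * sqrt (m y))) (at y within {0..})"
          using D[OF r(1)] unfolding key[OF r(1)] r(2) .
      qed
      then show "((\<lambda>x. x - 1 / cmod (U x)) has_real_derivative 1 + k y / (m y * cmod (U y))) (at y within {0..})"
        by (simp add: m_def)
      show "0 \<le> 1 + k y / (m y * cmod (U y))"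
        using k_abs[OF y] m_pos[OF y] U0 by (simp add: field_simps)
    qed (use that in auto)
    then show ?thesis
      by (simp add: \<alpha>_def)
  qed
  \<comment> \<open>\<open>X \<ge> 1 / \<alpha>\<close> gives \<open>1 / |U X| \<le> 2 X\<close>,
    hence \<open>X \<le> 2 X^2 |U X| \<le> 2 C\<close>, contrary to
    \<open>X \<ge> 2 C + 1\<close>.\<close>
  define X where "X = max (1 / \<alpha>) (2 * C + 1)"
  have X: "X \<ge> 1 / \<alpha>" "X \<ge> 2 * C + 1" "X > 0"
    using \<alpha> by (auto simp: X_def less_max_iff_disj)
  have U0: "cmod (U X) > 0"
    using m_pos[of X] X by (simp add: m_def)
  have "1 / cmod (U X) \<le> 2 * X"
    using lower[of X] X by simp
  then have "1 \<le> 2 * X * cmod (U X)"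
    using U0 by (simp add: field_simps)
  then have "X * 1 \<le> X * (2 * X * cmod (U X))"
    using X by (intro mult_left_mono) auto
  moreover have "X\<^sup>2 * cmod (U X) \<le> C"
    using bounds(3)[of X] X by (simp add: norm_mult norm_power)
  moreover have "X * (2 * X * cmod (U X)) = 2 * (X\<^sup>2 * cmod (U X))"
    by (simp add: power2_eq_square)
  ultimately show False
    using X by linarith
qed

text \<open>The unit factor \<open>\<kappa>\<close> is the common phase of the data at a fixed time
  and cancels in \<open>V U*\<close>. At \<open>x = 0\<close>, zero momentum makes \<open>c\<close>
  real, \<open>k \<le> 0\<close> fixes its sign and zero energy fixes its modulus.\<close>

lemma initial_data:
  assumes "U 0 = of_real \<alpha> * \<kappa>" "V 0 = c * \<kappa>" "cmod \<kappa> = 1" "\<alpha> > 0"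
  shows "\<omega> > 0" and "c = of_real (- \<alpha> * sqrt (\<omega> + \<alpha>\<^sup>2))"
proof -
  have m0: "m 0 = \<alpha>\<^sup>2"
    using assms by (simp add: m_def norm_mult)
  show \<omega>: "\<omega> > 0"
    using omega_nonneg omega_nonzero assms(4) m0 by force
  have "V 0 * cnj (U 0) = of_real \<alpha> * c * (\<kappa> * cnj \<kappa>)"
    by (simp add: assms(1,2))
  also have "\<kappa> * cnj \<kappa> = 1"
    using complex_norm_square[of \<kappa>] assms(3) by simp
  finally have VU: "V 0 * cnj (U 0) = of_real \<alpha> * c"
    by simp
  have im: "Im c = 0"
    using momentum_zero[of 0] assms(4) by (simp add: J_def VU)
  have re: "Re c \<le> 0"
    using k_nonpos[of 0] \<omega> assms(4) by (simp add: k_def VU mult_le_0_iff)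
  have "(Re c)\<^sup>2 = \<alpha>\<^sup>2 * (\<omega> + \<alpha>\<^sup>2)"
    using energy_zero[of 0] assms(2,3) im by (simp add: m0 n_def norm_mult cmod_power2 power_mult_distrib)
  also have "\<dots> = (\<alpha> * sqrt (\<omega> + \<alpha>\<^sup>2))\<^sup>2"
    using \<omega> by (simp add: power_mult_distrib)
  finally have "\<bar>Re c\<bar> = \<bar>\<alpha> * sqrt (\<omega> + \<alpha>\<^sup>2)\<bar>"
    by (rule power2_eq_iff[THEN iffD1, THEN disjE]) auto
  then have "Re c = - \<alpha> * sqrt (\<omega> + \<alpha>\<^sup>2)"
    using re \<omega> assms(4) by (simp add: abs_mult)
  then show "c = of_real (- \<alpha> * sqrt (\<omega> + \<alpha>\<^sup>2))"
    using im by (simp add: complex_eq_iff)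
qed

end

section \<open>Time translation, periodicity and the necessary condition\<close>

lemma phase_has_vector_derivative:
  "((\<lambda>t. exp (\<i> * of_real (\<omega> * (t - T)))) has_vector_derivative
      \<i> * of_real \<omega> * exp (\<i> * of_real (\<omega> * (t - T)))) (at t within S)"
proof -
  have "((\<lambda>z. exp (\<i> * of_real \<omega> * (z - of_real T))) has_field_derivative
      \<i> * of_real \<omega> * exp (\<i> * of_real \<omega> * (of_real t - of_real T))) (at (of_real t))"
    by (auto intro!: derivative_eq_intros)
  from has_vector_derivative_real_field[OF this] show ?thesis
    by (simp add: mult.assoc)
qed

text \<open>Invariance under time translation and under constant rotation:
  \<open>|\<kappa>| = 1\<close> leaves the cubic coefficient unchanged, and \<open>h \<ge> 0\<close>
  keeps \<open>t + h\<close> inside the strip.\<close>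

lemma nls_strip_shift:
  assumes "nls_strip t0 u ux ut uxx uxt" "h \<ge> 0" "cmod \<kappa> = 1"
  shows "nls_strip t0 (\<lambda>x t. \<kappa> * u x (t + h)) (\<lambda>x t. \<kappa> * ux x (t + h)) (\<lambda>x t. \<kappa> * ut x (t + h))
           (\<lambda>x t. \<kappa> * uxx x (t + h)) (\<lambda>x t. \<kappa> * uxt x (t + h))"
proof -
  interpret nls_strip t0 u ux ut uxx uxt by fact
  have c: "continuous_on ({0..} \<times> {t0..}) (\<lambda>(x, t). \<kappa> * f x (t + h))"
    if "continuous_on ({0..} \<times> {t0..}) (\<lambda>(x, t). f x t)" for f :: "real \<Rightarrow> real \<Rightarrow> complex"
  proof -
    have "continuous_on ({0..} \<times> {t0..}) (\<lambda>q. (\<lambda>(x, t). f x t) (fst q, snd q + h))"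
      by (rule continuous_on_compose2[OF that]) (use assms(2) in \<open>auto intro!: continuous_intros\<close>)
    then show ?thesis
      by (auto simp: case_prod_unfold intro!: continuous_intros)
  qed
  have dt: "((\<lambda>t. \<kappa> * f (t + h)) has_vector_derivative \<kappa> * f') (at t within {t0..})"
    if "(f has_vector_derivative f') (at (t + h) within {t0..})" for f :: "real \<Rightarrow> complex" and f' t
  proof -
    have "((\<lambda>t. t + h) has_vector_derivative 1) (at t within {t0..})"
      by (auto intro!: derivative_eq_intros)
    moreover have "(f has_vector_derivative f') (at (t + h) within (\<lambda>t. t + h) ` {t0..})"
      by (rule has_vector_derivative_within_subset[OF that]) (use assms(2) in auto)
    ultimately have "(f \<circ> (\<lambda>t. t + h) has_vector_derivative 1 *\<^sub>R f') (at t within {t0..})"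
      by (rule vector_diff_chain_within)
    then show ?thesis
      by (intro has_vector_derivative_mult_right) (simp add: o_def)
  qed
  show ?thesis
  proof
    fix x t :: real assume xt: "x \<ge> 0" "t \<ge> t0"
    then have xt': "x \<ge> 0" "t + h \<ge> t0"
      using assms(2) by auto
    show "((\<lambda>x. \<kappa> * u x (t + h)) has_vector_derivative \<kappa> * ux x (t + h)) (at x within {0..})"
      "((\<lambda>x. \<kappa> * ux x (t + h)) has_vector_derivative \<kappa> * uxx x (t + h)) (at x within {0..})"
      "((\<lambda>x. \<kappa> * ut x (t + h)) has_vector_derivative \<kappa> * uxt x (t + h)) (at x within {0..})"
      by (intro has_vector_derivative_mult_right deriv xt')+
    show "((\<lambda>t. \<kappa> * u x (t + h)) has_vector_derivative \<kappa> * ut x (t + h)) (at t within {t0..})"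
      "((\<lambda>t. \<kappa> * ux x (t + h)) has_vector_derivative \<kappa> * uxt x (t + h)) (at t within {t0..})"
      by (rule dt, rule deriv[OF xt'])+
    have "\<i> * (\<kappa> * ut x (t + h)) + \<kappa> * uxx x (t + h) = \<kappa> * (\<i> * ut x (t + h) + uxx x (t + h))"
      by (simp add: algebra_simps)
    then show "\<i> * (\<kappa> * ut x (t + h)) + \<kappa> * uxx x (t + h)
        = 2 * of_real ((cmod (\<kappa> * u x (t + h)))\<^sup>2) * (\<kappa> * u x (t + h))"
      unfolding nls[OF xt'] by (simp add: norm_mult assms(3))
  qed (rule c, rule cont)+
qed

text \<open>
  Translating \<open>u\<close> in time and undoing the phase does not change the Cauchy data at \<open>x = 0\<close>,
  so uniqueness makes \<open>u\<close> exactly time periodic.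
\<close>

lemma time_periodic:
  assumes u: "nls_strip t0 u ux ut uxx uxt"
    and data: "\<And>t. t \<ge> t0 \<Longrightarrow> u 0 t = of_real \<alpha> * exp (\<i> * of_real (\<omega> * t))"
      "\<And>t. t \<ge> t0 \<Longrightarrow> ux 0 t = c * exp (\<i> * of_real (\<omega> * t))"
    and "x \<ge> 0" "t > t0" "h \<ge> 0"
  shows "u x (t + h) = exp (\<i> * of_real (\<omega> * h)) * u x t"
proof -
  define \<kappa> where "\<kappa> = exp (- (\<i> * of_real (\<omega> * h)))"
  have \<kappa>: "cmod \<kappa> = 1"
    by (simp add: \<kappa>_def)
  have phase: "\<kappa> * exp (\<i> * of_real (\<omega> * (s + h))) = exp (\<i> * of_real (\<omega> * s))" for s
    unfolding \<kappa>_def exp_add[symmetric] by (simp add: algebra_simps)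
  have "\<kappa> * u x (t + h) = u x t"
  proof (rule nls_cauchy_unique[OF u nls_strip_shift[OF u \<open>h \<ge> 0\<close> \<kappa>]])
    fix s assume "s \<ge> t0"
    then have s: "s \<ge> t0" "s + h \<ge> t0"
      using \<open>h \<ge> 0\<close> by auto
    have "\<kappa> * (b * exp (\<i> * of_real (\<omega> * (s + h)))) = b * exp (\<i> * of_real (\<omega> * s))" for b
      by (simp only: mult.left_commute[of \<kappa> b] phase)
    then show "\<kappa> * u 0 (s + h) = u 0 s" "\<kappa> * ux 0 (s + h) = ux 0 s"
      by (simp_all only: data[OF s(1)] data[OF s(2)])
  qed fact+
  moreover have "exp (\<i> * of_real (\<omega> * h)) * \<kappa> = 1"
    unfolding \<kappa>_def exp_add[symmetric] by simp
  ultimately show ?thesis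
    by (metis mult.assoc mult_1)
qed

lemma schwartz_half_weighted_bound:
  assumes "schwartz_half f"
  shows "\<exists>C. \<forall>x\<ge>0. cmod (of_real (x ^ j) * (deriv_half ^^ k) f x) \<le> C"
  using assms unfolding schwartz_half_def bounded_iff by fastforce

text \<open>At a time \<open>T > t0\<close> periodicity gives \<open>u_t = i \<omega> u\<close>,
  which turns the equation into the stationary one. The slice at \<open>T\<close> is Schwartz, hence
  a decaying profile whose data at \<open>x = 0\<close> are \<open>\<alpha>\<close> and
  \<open>c\<close> times one phase.\<close>

lemma eventually_admissible_necessary:
  assumes "nls_quarter_solution u" "t0 > 0" "\<alpha> > 0"
    and data: "\<And>t. t \<ge> t0 \<Longrightarrow> u 0 t = of_real \<alpha> * exp (\<i> * of_real (\<omega> * t))"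
      "\<And>t. t \<ge> t0 \<Longrightarrow> pdx u 0 t = c * exp (\<i> * of_real (\<omega> * t))"
  shows "(\<alpha>, \<omega>, c) \<in> admissible_triples"
proof -
  have strip: "nls_strip t0 u (pdx u) (pdt u) (pdx (pdx u)) (pdx (pdt u))"
    using nls_quarter_solution_strip assms by blast
  interpret nls_strip t0 u "pdx u" "pdt u" "pdx (pdx u)" "pdx (pdt u)"
    by fact
  define T where "T = t0 + 1"
  have T: "T > t0" "T \<ge> t0" "T \<ge> 0"
    using assms by (auto simp: T_def)
  \<comment> \<open>Periodicity is applied forward from \<open>T\<close>, so the two candidates for
    the time derivative are compared within \<open>{T..}\<close>.\<close>
  have ut: "pdt u x T = \<i> * of_real \<omega> * u x T" if x: "x \<ge> 0" for x
  proof (rule vector_derivative_unique_within)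
    show "at T within {T..} \<noteq> bot"
      by (rule at_within_atLeast_neq_bot) simp
    show "(u x has_vector_derivative pdt u x T) (at T within {T..})"
      by (rule has_vector_derivative_within_subset[OF deriv(4)[OF x T(2)]]) (use T in auto)
    have "((\<lambda>t. exp (\<i> * of_real (\<omega> * (t - T))) * u x T) has_vector_derivative \<i> * of_real \<omega> * u x T)
        (at T within {T..})"
      by (rule has_vector_derivative_eq_rhs[OF has_vector_derivative_mult_left[OF phase_has_vector_derivative]]) simp
    then show "(u x has_vector_derivative \<i> * of_real \<omega> * u x T) (at T within {T..})"
    proof (rule has_vector_derivative_transform[rotated 2])
      fix t assume "t \<in> {T..}"
      then show "u x t = exp (\<i> * of_real (\<omega> * (t - T))) * u x T"
        using time_periodic[OF strip data x T(1), of "t - T"] by simp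
    qed simp
  qed
  have "schwartz_half (\<lambda>x. u x T)"
    using assms(1) T by (simp add: nls_quarter_solution_def)
  note sb = schwartz_half_weighted_bound[OF this]
  from sb[of 1 0] sb[of 1 1] sb[of 2 0] obtain C1 C2 C3 where C:
    "\<forall>x\<ge>0. cmod (of_real x * u x T) \<le> C1"
    "\<forall>x\<ge>0. cmod (of_real x * pdx u x T) \<le> C2"
    "\<forall>x\<ge>0. cmod (of_real (x\<^sup>2) * u x T) \<le> C3"
    by (auto simp: pdx_def)
  interpret decaying_profile "\<lambda>x. u x T" "\<lambda>x. pdx u x T" \<omega> "max C1 (max C2 C3)"
  proof
    fix x :: real assume x: "x \<ge> 0"
    show "((\<lambda>x. u x T) has_vector_derivative pdx u x T) (at x within {0..})"
      by (rule deriv(1)[OF x T(2)])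
    have "pdx (pdx u) x T = of_real (\<omega> + 2 * (cmod (u x T))\<^sup>2) * u x T"
      using nls[OF x T(2)] unfolding ut[OF x] by (simp add: algebra_simps)
    then show "((\<lambda>x. pdx u x T) has_vector_derivative of_real (\<omega> + 2 * (cmod (u x T))\<^sup>2) * u x T) (at x within {0..})"
      using deriv(2)[OF x T(2)] by simp
  qed (use C in \<open>auto simp: le_max_iff_disj\<close>)
  have "cmod (exp (\<i> * of_real (\<omega> * T))) = 1"
    by simp
  from initial_data[OF data(1)[OF T(2)] data(2)[OF T(2)] this \<open>\<alpha> > 0\<close>]
  show ?thesis
    using \<open>\<alpha> > 0\<close> by (auto simp: admissible_triples_def)
qed

section \<open>The explicit solution\<close>

lemma deriv_half_eqI:
  assumes "x \<ge> 0" "(f has_vector_derivative f') (at x within {0..})"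
  shows "deriv_half f x = f'"
  unfolding deriv_half_def
  using assms at_within_atLeast_neq_bot vector_derivative_within by blast

text \<open>The iterate is matched with a member of the class only for \<open>x \<ge> 0\<close>: at
  negative points \<open>deriv_half\<close> is unspecified, and derivatives within
  \<open>{0..}\<close> do not see those points.\<close>

lemma deriv_half_class:
  assumes closed: "\<And>f. P f \<Longrightarrow> \<exists>f'. P f' \<and> (\<forall>x\<ge>0. (f has_vector_derivative f' x) (at x within {0..}))"
    and "P f"
  shows "\<exists>g. P g \<and> (\<forall>x\<ge>0. (deriv_half ^^ k) f x = g x)"
proof (induction k)
  case 0
  then show ?case using assms by auto
next
  case (Suc k)
  then obtain g where g: "P g" "\<And>x. x \<ge> 0 \<Longrightarrow> (deriv_half ^^ k) f x = g x"
    by blast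
  obtain g' where g': "P g'" "\<And>x. x \<ge> 0 \<Longrightarrow> (g has_vector_derivative g' x) (at x within {0..})"
    using closed[OF g(1)] by blast
  have "deriv_half ((deriv_half ^^ k) f) x = g' x" if "x \<ge> 0" for x
    by (rule deriv_half_eqI[OF that has_vector_derivative_transform[OF _ _ g'(2)[OF that]]])
       (use that g(2) in auto)
  then show ?case
    using g'(1) by auto
qed

lemma smooth_half_class:
  assumes closed: "\<And>f. P f \<Longrightarrow> \<exists>f'. P f' \<and> (\<forall>x\<ge>0. (f has_vector_derivative f' x) (at x within {0..}))"
    and "P f"
  shows "smooth_half f"
  unfolding smooth_half_def
proof (intro allI impI)
  fix k and x :: real assume x: "x \<ge> 0"
  obtain g where g: "P g" "\<And>x. x \<ge> 0 \<Longrightarrow> (deriv_half ^^ k) f x = g x"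
    using deriv_half_class[of P f k, OF closed \<open>P f\<close>] by blast
  obtain g' where "\<And>x. x \<ge> 0 \<Longrightarrow> (g has_vector_derivative g' x) (at x within {0..})"
    using closed[OF g(1)] by blast
  from this[OF x] have "((deriv_half ^^ k) f has_vector_derivative g' x) (at x within {0..})"
    by (rule has_vector_derivative_transform[rotated 2]) (use x g(2) in auto)
  then show "(deriv_half ^^ k) f differentiable at x within {0..}"
    by (rule differentiableI_vector)
qed

lemma smooth_half_phase: "smooth_half (\<lambda>t. c * exp (\<i> * of_real (\<omega> * t)))"
proof (rule smooth_half_class[where P = "\<lambda>f. \<exists>c. f = (\<lambda>t. c * exp (\<i> * of_real (\<omega> * t)))"])
  fix f :: "real \<Rightarrow> complex" assume "\<exists>c. f = (\<lambda>t. c * exp (\<i> * of_real (\<omega> * t)))"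
  then obtain c where f: "f = (\<lambda>t. c * exp (\<i> * of_real (\<omega> * t)))"
    by blast
  have "(f has_vector_derivative c * (\<i> * of_real \<omega>) * exp (\<i> * of_real (\<omega> * t))) (at t within {0..})" for t
    using has_vector_derivative_mult_right[OF phase_has_vector_derivative[of \<omega> 0 t "{0..}"], of c]
    by (simp add: f mult.assoc)
  then show "\<exists>f'. (\<exists>c. f' = (\<lambda>t. c * exp (\<i> * of_real (\<omega> * t)))) \<and>
      (\<forall>x\<ge>0. (f has_vector_derivative f' x) (at x within {0..}))"
    by blast
qed blast

text \<open>Induction on \<open>n\<close> with \<open>f\<close> and \<open>u\<close> arbitrary:
  \<open>pdx\<close> replaces the factor \<open>f\<close> by \<open>f'\<close> and
  \<open>pdt\<close> replaces it by \<open>i \<omega> f\<close>, both in the class again. The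
  product form is asked only on the quarter plane, where it passes to \<open>pdx u\<close> and
  \<open>pdt u\<close>.\<close>

lemma Cn_quarter_separated:
  assumes closed: "\<And>f. P f \<Longrightarrow> \<exists>f'. P f' \<and> (\<forall>x\<ge>0. (f has_vector_derivative f' x) (at x within {0..}))"
    and scale: "\<And>f c. P f \<Longrightarrow> P (\<lambda>x. c * f x)"
    and "P f" "\<And>x t. x \<ge> 0 \<Longrightarrow> t \<ge> 0 \<Longrightarrow> u x t = f x * exp (\<i> * of_real (\<omega> * t))"
  shows "Cn_quarter n u"
  using assms(3,4)
proof (induction n arbitrary: f u)
  case (0 f u)
  obtain f' where "\<And>x. x \<ge> 0 \<Longrightarrow> (f has_vector_derivative f' x) (at x within {0..})"
    using closed[OF 0(1)] by blast
  then have "continuous_on {0..} f"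
    by (intro continuous_on_vector_derivative) auto
  then have "continuous_on ({0..} \<times> {0::real..}) (\<lambda>q. f (fst q))"
    by (rule continuous_on_compose2) (auto intro!: continuous_intros)
  then have "continuous_on ({0..} \<times> {0..}) (\<lambda>q. f (fst q) * exp (\<i> * of_real (\<omega> * snd q)))"
    by (intro continuous_intros)
  then have "continuous_on ({0..} \<times> {0..}) (\<lambda>q. u (fst q) (snd q))"
    by (rule continuous_on_eq) (use 0(2) in auto)
  then show ?case
    by (simp add: case_prod_unfold)
next
  case (Suc n f u)
  obtain f' where f': "P f'" "\<And>x. x \<ge> 0 \<Longrightarrow> (f has_vector_derivative f' x) (at x within {0..})"
    using closed[OF Suc(2)] by blast
  have dx: "((\<lambda>y. u y t) has_vector_derivative f' x * exp (\<i> * of_real (\<omega> * t))) (at x within {0..})"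
    if "x \<ge> 0" "t \<ge> 0" for x t
    by (rule has_vector_derivative_transform[rotated 2, OF has_vector_derivative_mult_left[OF f'(2)[OF that(1)]]])
       (use that Suc(3) in auto)
  have dt: "((\<lambda>s. u x s) has_vector_derivative (\<i> * of_real \<omega> * f x) * exp (\<i> * of_real (\<omega> * t))) (at t within {0..})"
    if "x \<ge> 0" "t \<ge> 0" for x t
  proof (rule has_vector_derivative_transform)
    show "((\<lambda>t. f x * exp (\<i> * of_real (\<omega> * t))) has_vector_derivative
        (\<i> * of_real \<omega> * f x) * exp (\<i> * of_real (\<omega> * t))) (at t within {0..})"
      using has_vector_derivative_mult_right[OF phase_has_vector_derivative[of \<omega> 0 t "{0..}"], of "f x"]
      by (simp add: mult_ac)
  qed (use that Suc(3) in auto)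
  have "Cn_quarter n (pdx u)"
    by (rule Suc.IH[OF f'(1)]) (simp add: pdx_def deriv_half_eqI[OF _ dx])
  moreover have "Cn_quarter n (pdt u)"
    by (rule Suc.IH[OF scale[OF Suc(2), of "\<i> * of_real \<omega>"]]) (simp add: pdt_def deriv_half_eqI[OF _ dt])
  ultimately show ?case
    by (auto intro!: differentiableI_vector[OF dx] differentiableI_vector[OF dt])
qed

section \<open>The stationary profile and its decay\<close>

locale soliton =
  fixes \<alpha> \<omega> :: real
  assumes \<alpha>: "\<alpha> > 0" and \<omega>: "\<omega> > 0"
begin

definition "s = sqrt \<omega>"
definition "S = sqrt (\<alpha>\<^sup>2 + \<omega>)"
text \<open>The stated denominator is \<open>(S + s) ((S + s) e^(2 s x) - (S - s))\<close>, because
  \<open>\<alpha>^2 = S^2 - s^2\<close>. Dividing it by \<open>(S + s) e^(2 s x)\<close> leaves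
  decaying exponentials only.\<close>

definition "den x = (S + s) - (S - s) * exp (- (2 * s * x))"
text \<open>This is \<open>s / sinh (s (x + x0))\<close> with
  \<open>e^(- 2 s x0) = (S - s) / (S + s)\<close>; its pole lies at \<open>- x0 < 0\<close>, outside
  the half-line.\<close>

definition "U x = 2 * \<alpha> * s * exp (- (s * x)) / den x"
text \<open>The negative logarithmic derivative of \<open>U\<close>, that is
  \<open>s coth (s (x + x0))\<close>.\<close>

definition "W x = s * ((S + s) + (S - s) * exp (- (2 * s * x))) / den x"

lemma s_pos: "s > 0" and s_sq: "s\<^sup>2 = \<omega>"
  using \<omega> by (simp_all add: s_def)

lemma S_gt: "S > s" and S_sq: "S\<^sup>2 = \<alpha>\<^sup>2 + \<omega>"
  using \<alpha> \<omega> by (simp_all add: s_def S_def)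

lemma den_ge:
  assumes "x \<ge> 0"
  shows "den x \<ge> 2 * s"
proof -
  have "(S - s) * exp (- (2 * s * x)) \<le> (S - s) * 1"
    using S_gt s_pos assms by (intro mult_left_mono) auto
  then show ?thesis
    by (simp add: den_def)
qed

lemma den_pos: "x \<ge> 0 \<Longrightarrow> den x > 0"
  using den_ge[of x] s_pos by simp

text \<open>The zero-energy relation \<open>U'^2 = U^2 (\<omega> + U^2)\<close> divided by
  \<open>U^2\<close>. In terms of \<open>q = e^(- s x)\<close> it is a difference of two squares
  together with \<open>S^2 - s^2 = \<alpha>^2\<close>.\<close>

lemma W_sq:
  assumes "x \<ge> 0"
  shows "(W x)\<^sup>2 = \<omega> + (U x)\<^sup>2"
proof -
  define q where "q = exp (- (s * x))"
  have q: "exp (- (2 * s * x)) = q\<^sup>2"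
    by (simp add: q_def power2_eq_square flip: exp_add)
  have d: "(S + s) - (S - s) * q\<^sup>2 \<noteq> 0"
    using den_pos[OF assms] by (simp add: den_def q)
  have "(s * ((S + s) + (S - s) * q\<^sup>2))\<^sup>2
      = s\<^sup>2 * ((S + s) - (S - s) * q\<^sup>2)\<^sup>2 + 4 * (S\<^sup>2 - s\<^sup>2) * s\<^sup>2 * q\<^sup>2"
    by algebra
  also have "\<dots> = \<omega> * ((S + s) - (S - s) * q\<^sup>2)\<^sup>2 + (2 * \<alpha> * s * q)\<^sup>2"
    by (simp add: S_sq s_sq power_mult_distrib)
  finally show ?thesis
    using d unfolding W_def U_def den_def q q_def[symmetric] power_divide
    by (simp add: field_simps)
qed

lemma U_deriv:
  assumes "x \<ge> 0"
  shows "(U has_real_derivative - U x * W x) (at x within {0..})"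
proof -
  define q where "q = exp (- (s * x))"
  have q: "exp (- (2 * s * x)) = q\<^sup>2"
    by (simp add: q_def power2_eq_square flip: exp_add)
  have d: "den x \<noteq> 0"
    using den_pos[OF assms] by simp
  have dd: "(den has_real_derivative (S - s) * (2 * s * exp (- (2 * s * x)))) (at x within {0..})"
    unfolding den_def[abs_def] by (auto intro!: derivative_eq_intros)
  have "((\<lambda>x. 2 * \<alpha> * s * exp (- (s * x))) has_real_derivative - 2 * \<alpha> * s\<^sup>2 * q) (at x within {0..})"
    by (auto intro!: derivative_eq_intros simp: q_def power2_eq_square)
  note D = DERIV_divide[OF this dd d]
  have num: "(- 2 * \<alpha> * s\<^sup>2 * q) * den x - 2 * \<alpha> * s * q * ((S - s) * (2 * s * q\<^sup>2))
     = - (2 * \<alpha> * s * q) * (s * ((S + s) + (S - s) * q\<^sup>2))"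
    unfolding den_def q by algebra
  show ?thesis
    using D unfolding U_def[abs_def] W_def q q_def[symmetric] num by simp
qed

lemma W_deriv:
  assumes "x \<ge> 0"
  shows "(W has_real_derivative - (U x)\<^sup>2) (at x within {0..})"
proof -
  define q where "q = exp (- (s * x))"
  have q: "exp (- (2 * s * x)) = q\<^sup>2"
    by (simp add: q_def power2_eq_square flip: exp_add)
  have d: "den x \<noteq> 0"
    using den_pos[OF assms] by simp
  have dd: "(den has_real_derivative (S - s) * (2 * s * exp (- (2 * s * x)))) (at x within {0..})"
    unfolding den_def[abs_def] by (auto intro!: derivative_eq_intros)
  have "((\<lambda>x. s * ((S + s) + (S - s) * exp (- (2 * s * x)))) has_real_derivative
      - 2 * s\<^sup>2 * (S - s) * q\<^sup>2) (at x within {0..})"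
    by (auto intro!: derivative_eq_intros simp: q power2_eq_square)
  note D = DERIV_divide[OF this dd d]
  have "(- 2 * s\<^sup>2 * (S - s) * q\<^sup>2) * den x - s * ((S + s) + (S - s) * exp (- (2 * s * x))) * ((S - s) * (2 * s * exp (- (2 * s * x))))
     = - 4 * (S\<^sup>2 - s\<^sup>2) * s\<^sup>2 * q\<^sup>2"
    unfolding den_def q by algebra
  also have "\<dots> = - (2 * \<alpha> * s * q)\<^sup>2"
    by (simp add: S_sq s_sq power_mult_distrib)
  finally have num: "(- 2 * s\<^sup>2 * (S - s) * q\<^sup>2) * den x - s * ((S + s) + (S - s) * q\<^sup>2) * ((S - s) * (2 * s * q\<^sup>2))
     = - (2 * \<alpha> * s * q)\<^sup>2"
    unfolding q .
  show ?thesis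
    using D unfolding W_def[abs_def] U_def q q_def[symmetric] num
    by (simp add: power_divide power2_eq_square)
qed

lemma U_0: "U 0 = \<alpha>" and W_0: "W 0 = S"
  using s_pos by (simp_all add: U_def W_def den_def)

lemma U_nonneg: "x \<ge> 0 \<Longrightarrow> U x \<ge> 0"
  using \<alpha> s_pos den_pos[of x] by (simp add: U_def)

lemma U_bound:
  assumes "x \<ge> 0"
  shows "\<bar>U x\<bar> \<le> \<alpha> * exp (- (s * x))"
proof -
  have "U x \<le> 2 * \<alpha> * s * exp (- (s * x)) / (2 * s)"
    unfolding U_def using den_ge[OF assms] den_pos[OF assms] s_pos \<alpha> by (intro divide_left_mono) auto
  then show ?thesis
    using s_pos U_nonneg[OF assms] by simp
qed

lemma U_le: "x \<ge> 0 \<Longrightarrow> \<bar>U x\<bar> \<le> \<alpha>"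
  by (rule order_trans[OF U_bound]) (use s_pos \<alpha> in auto)

lemma W_le:
  assumes "x \<ge> 0"
  shows "\<bar>W x\<bar> \<le> S"
proof -
  have "(W x)\<^sup>2 \<le> S\<^sup>2"
    using W_sq[OF assms] S_sq power_mono[OF U_le[OF assms], of 2] by simp
  then show ?thesis
    using S_gt s_pos abs_le_square_iff[of "W x" S] by simp
qed

text \<open>
  Since \<open>U' = - U W\<close> and \<open>W' = - U\<^sup>2\<close>, the polynomials in \<open>U\<close> and \<open>W\<close> that are divisible by \<open>U\<close>
  are closed under differentiation and decay like \<open>U\<close>.
\<close>

inductive profile :: "(real \<Rightarrow> complex) \<Rightarrow> bool" where
  base: "profile (\<lambda>x. of_real (U x))"
| scale: "profile f \<Longrightarrow> profile (\<lambda>x. c * f x)"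
| add: "profile f \<Longrightarrow> profile g \<Longrightarrow> profile (\<lambda>x. f x + g x)"
| mult_U: "profile f \<Longrightarrow> profile (\<lambda>x. of_real (U x) * f x)"
| mult_W: "profile f \<Longrightarrow> profile (\<lambda>x. of_real (W x) * f x)"

lemma U_has_vector_derivative:
    "x \<ge> 0 \<Longrightarrow> ((\<lambda>x. complex_of_real (U x)) has_vector_derivative of_real (- U x * W x)) (at x within {0..})"
  and W_has_vector_derivative:
    "x \<ge> 0 \<Longrightarrow> ((\<lambda>x. complex_of_real (W x)) has_vector_derivative of_real (- (U x)\<^sup>2)) (at x within {0..})"
  by (rule has_vector_derivative_of_real, erule U_deriv W_deriv)+

lemma profile_deriv:
  "profile f \<Longrightarrow> \<exists>f'. profile f' \<and> (\<forall>x\<ge>0. (f has_vector_derivative f' x) (at x within {0..}))"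
proof (induction rule: profile.induct)
  case base
  have "profile (\<lambda>x. (-1) * (of_real (W x) * of_real (U x)))"
    by (intro profile.intros)
  moreover have "((\<lambda>x. complex_of_real (U x)) has_vector_derivative (-1) * (of_real (W x) * of_real (U x))) (at x within {0..})"
    if "x \<ge> 0" for x
    using U_has_vector_derivative[OF that] by (simp add: mult.commute)
  ultimately show ?case by blast
next
  case (scale f c)
  then obtain f' where "profile f'" "\<And>x. x \<ge> 0 \<Longrightarrow> (f has_vector_derivative f' x) (at x within {0..})"
    by blast
  then show ?case
    by (intro exI[of _ "\<lambda>x. c * f' x"]) (auto intro: profile.intros has_vector_derivative_mult_right)
next
  case (add f g)
  then obtain f' g' where "profile f'" "\<And>x. x \<ge> 0 \<Longrightarrow> (f has_vector_derivative f' x) (at x within {0..})"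
    "profile g'" "\<And>x. x \<ge> 0 \<Longrightarrow> (g has_vector_derivative g' x) (at x within {0..})"
    by blast
  then show ?case
    by (intro exI[of _ "\<lambda>x. f' x + g' x"]) (auto intro: profile.intros has_vector_derivative_add)
next
  case (mult_U f)
  then obtain f' where f': "profile f'" "\<And>x. x \<ge> 0 \<Longrightarrow> (f has_vector_derivative f' x) (at x within {0..})"
    by blast
  have "profile (\<lambda>x. of_real (U x) * f' x + (-1) * (of_real (W x) * (of_real (U x) * f x)))"
    using mult_U f' by (intro profile.intros)
  moreover have "((\<lambda>x. of_real (U x) * f x) has_vector_derivative
      of_real (U x) * f' x + (-1) * (of_real (W x) * (of_real (U x) * f x))) (at x within {0..})" if "x \<ge> 0" for x
    by (rule has_vector_derivative_eq_rhs[OF has_vector_derivative_mult[OF U_has_vector_derivative[OF that] f'(2)[OF that]]])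
       (simp add: algebra_simps)
  ultimately show ?case by blast
next
  case (mult_W f)
  then obtain f' where f': "profile f'" "\<And>x. x \<ge> 0 \<Longrightarrow> (f has_vector_derivative f' x) (at x within {0..})"
    by blast
  have "profile (\<lambda>x. of_real (W x) * f' x + (-1) * (of_real (U x) * (of_real (U x) * f x)))"
    using mult_W f' by (intro profile.intros)
  moreover have "((\<lambda>x. of_real (W x) * f x) has_vector_derivative
      of_real (W x) * f' x + (-1) * (of_real (U x) * (of_real (U x) * f x))) (at x within {0..})" if "x \<ge> 0" for x
    by (rule has_vector_derivative_eq_rhs[OF has_vector_derivative_mult[OF W_has_vector_derivative[OF that] f'(2)[OF that]]])
       (simp add: algebra_simps power2_eq_square)
  ultimately show ?case by blast
qed

text \<open>\<open>U\<close> itself decays at rate \<open>s\<close>; the further factors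
  \<open>U\<close> and \<open>W\<close> are bounded by \<open>\<alpha>\<close> and \<open>S\<close>,
  so every constructor preserves the rate.\<close>

lemma profile_decay:
  "profile f \<Longrightarrow> \<exists>C. \<forall>x\<ge>0. cmod (f x) \<le> C * exp (- (s * x))"
proof (induction rule: profile.induct)
  case base
  then show ?case
    using U_bound by auto
next
  case (scale f c)
  then obtain C where "\<And>x. x \<ge> 0 \<Longrightarrow> cmod (f x) \<le> C * exp (- (s * x))"
    by blast
  then show ?case
    by (intro exI[of _ "cmod c * C"]) (auto simp: norm_mult mult.assoc intro!: mult_left_mono)
next
  case (add f g)
  then obtain C D where "\<And>x. x \<ge> 0 \<Longrightarrow> cmod (f x) \<le> C * exp (- (s * x))"
    "\<And>x. x \<ge> 0 \<Longrightarrow> cmod (g x) \<le> D * exp (- (s * x))"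
    by blast
  then show ?case
    by (intro exI[of _ "C + D"]) (auto simp: distrib_right intro!: order_trans[OF norm_triangle_ineq] add_mono)
next
  case (mult_U f)
  then obtain C where C: "\<And>x. x \<ge> 0 \<Longrightarrow> cmod (f x) \<le> C * exp (- (s * x))"
    by blast
  have "cmod (of_real (U x) * f x) \<le> \<alpha> * (C * exp (- (s * x)))" if "x \<ge> 0" for x
    unfolding norm_mult using C[OF that] U_le[OF that] \<alpha> by (intro mult_mono) auto
  then show ?case
    by (metis mult.assoc)
next
  case (mult_W f)
  then obtain C where C: "\<And>x. x \<ge> 0 \<Longrightarrow> cmod (f x) \<le> C * exp (- (s * x))"
    by blast
  have "cmod (of_real (W x) * f x) \<le> S * (C * exp (- (s * x)))" if "x \<ge> 0" for x
    unfolding norm_mult using C[OF that] W_le[OF that] S_gt s_pos by (intro mult_mono) auto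
  then show ?case
    by (metis mult.assoc)
qed

lemma power_times_exp_bounded: "\<exists>C. \<forall>x\<ge>0. x ^ j * exp (- (s * x)) \<le> C"
proof (intro exI allI impI)
  fix x :: real assume x: "x \<ge> 0"
  have "(s * x) ^ j / fact j \<le> exp (s * x)"
  proof -
    \<comment> \<open>A single term of the exponential series is at most its sum; this yields the
      constant \<open>j! / s^j\<close>.\<close>
    have "(\<Sum>n\<in>{j}. (s * x) ^ n / fact n) \<le> (\<Sum>n. (s * x) ^ n / fact n)"
      using x s_pos summable_exp_generic[of "s * x"]
      by (intro sum_le_suminf) (auto simp: scaleR_conv_of_real divide_inverse mult.commute)
    then show ?thesis
      by (simp add: exp_def scaleR_conv_of_real divide_inverse mult.commute)
  qed
  then have "s ^ j * x ^ j \<le> fact j * exp (s * x)"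
    by (simp add: power_mult_distrib divide_le_eq mult.commute)
  then show "x ^ j * exp (- (s * x)) \<le> fact j / s ^ j"
    using s_pos by (simp add: exp_minus field_simps)
qed

lemma profile_schwartz:
  assumes "profile f"
  shows "schwartz_half f"
  unfolding schwartz_half_def
proof (intro conjI allI)
  show "smooth_half f"
    by (rule smooth_half_class[where P = profile, OF profile_deriv assms])
  fix j k
  obtain g where g: "profile g" "\<And>x. x \<ge> 0 \<Longrightarrow> (deriv_half ^^ k) f x = g x"
    using deriv_half_class[of profile, OF profile_deriv assms] by blast
  obtain C where C: "\<And>x. x \<ge> 0 \<Longrightarrow> cmod (g x) \<le> C * exp (- (s * x))"
    using profile_decay[OF g(1)] by blast
  obtain D where D: "\<And>x. x \<ge> 0 \<Longrightarrow> x ^ j * exp (- (s * x)) \<le> D"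
    using power_times_exp_bounded by blast
  have C0: "C \<ge> 0"
    using order_trans[OF norm_ge_zero C[of 0]] by simp
  have "cmod (of_real (x ^ j) * (deriv_half ^^ k) f x) \<le> C * D" if x: "x \<ge> 0" for x
  proof -
    have "cmod (of_real (x ^ j) * (deriv_half ^^ k) f x) = x ^ j * cmod (g x)"
      using x by (simp add: g(2) norm_mult norm_power)
    also have "\<dots> \<le> x ^ j * (C * exp (- (s * x)))"
      using x C by (intro mult_left_mono) auto
    also have "\<dots> = C * (x ^ j * exp (- (s * x)))"
      by simp
    also have "\<dots> \<le> C * D"
      using D[OF x] C0 by (rule mult_left_mono)
    finally show ?thesis .
  qed
  then show "bounded ((\<lambda>x. of_real (x ^ j) * (deriv_half ^^ k) f x) ` {0..})"
    unfolding bounded_iff by auto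
qed

section \<open>The explicit solution of the equation\<close>

definition "u x t = of_real (U x) * exp (\<i> * of_real (\<omega> * t))"

lemma pdx_u:
  assumes "x \<ge> 0"
  shows "pdx u x t = of_real (- U x * W x) * exp (\<i> * of_real (\<omega> * t))"
  unfolding pdx_def u_def
  by (rule deriv_half_eqI[OF assms has_vector_derivative_mult_left[OF U_has_vector_derivative[OF assms]]])

text \<open>Differentiating \<open>- U W\<close> gives \<open>U W^2 + U^3\<close>, and
  \<open>W^2 = \<omega> + U^2\<close> turns this into the stationary equation.\<close>

lemma pdx_pdx_u:
  assumes "x \<ge> 0"
  shows "pdx (pdx u) x t = of_real (U x * (\<omega> + 2 * (U x)\<^sup>2)) * exp (\<i> * of_real (\<omega> * t))"
  unfolding pdx_def[of "pdx u"]
proof (rule deriv_half_eqI[OF assms has_vector_derivative_transform])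
  have "((\<lambda>x. - U x * W x) has_real_derivative U x * (\<omega> + 2 * (U x)\<^sup>2)) (at x within {0..})"
  proof (rule DERIV_cong[OF DERIV_mult[OF DERIV_minus[OF U_deriv[OF assms]] W_deriv[OF assms]]])
    have "- (- U x * W x) * W x + - (U x)\<^sup>2 * - U x = U x * (W x)\<^sup>2 + U x * (U x)\<^sup>2"
      by (simp add: power2_eq_square)
    then show "- (- U x * W x) * W x + - (U x)\<^sup>2 * - U x = U x * (\<omega> + 2 * (U x)\<^sup>2)"
      unfolding W_sq[OF assms] by (simp add: algebra_simps)
  qed
  from has_vector_derivative_mult_left[OF has_vector_derivative_of_real[OF this]]
  show "((\<lambda>x. of_real (- U x * W x) * exp (\<i> * of_real (\<omega> * t))) has_vector_derivative
      of_real (U x * (\<omega> + 2 * (U x)\<^sup>2)) * exp (\<i> * of_real (\<omega> * t))) (at x within {0..})" .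
qed (use assms pdx_u in auto)

lemma pdt_u:
  assumes "t \<ge> 0"
  shows "pdt u x t = \<i> * of_real \<omega> * u x t"
  unfolding pdt_def
proof (rule deriv_half_eqI[OF assms])
  show "((\<lambda>t. u x t) has_vector_derivative \<i> * of_real \<omega> * u x t) (at t within {0..})"
    using has_vector_derivative_mult_right[OF phase_has_vector_derivative[of \<omega> 0 t "{0..}"], of "of_real (U x)"]
    by (simp add: u_def mult_ac)
qed

lemma u_solution: "nls_quarter_solution u"
  unfolding nls_quarter_solution_def
proof (intro conjI allI impI)
  show "smooth_quarter u"
    unfolding smooth_quarter_def
    by (intro allI Cn_quarter_separated[where P = profile and f = "\<lambda>x. of_real (U x)"] profile_deriv
        profile.scale profile.base) (auto simp: u_def)
  show "schwartz_half (\<lambda>x. u x t)" for t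
    using profile_schwartz[OF profile.scale[OF profile.base, of "exp (\<i> * of_real (\<omega> * t))"]]
    by (simp add: u_def mult.commute)
next
  fix x t :: real assume xt: "x > 0" "t > 0"
  have "cmod (u x t) = U x"
    using U_nonneg[of x] xt by (simp add: u_def norm_mult)
  then show "\<i> * pdt u x t + pdx (pdx u) x t - 2 * of_real ((cmod (u x t))\<^sup>2) * u x t = 0"
    using xt by (simp add: pdt_u pdx_pdx_u) (simp add: u_def algebra_simps)
next
  \<comment> \<open>The phase has modulus 1, so the \<open>L^1\<close> norm is the same number at
    every time, and a constant is \<open>O(t)\<close>.\<close>
  define c where "c = (LINT x:{0..}|lborel. \<bar>U x\<bar>)"
  have "(\<lambda>t. LINT x:{0..}|lborel. norm (u x t)) = (\<lambda>_. c)"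
    by (simp add: c_def u_def norm_mult)
  moreover have "(\<lambda>_. c) \<in> O[at_top](\<lambda>t::real. t)"
  proof (rule bigoI)
    show "eventually (\<lambda>t::real. norm c \<le> \<bar>c\<bar> * norm t) at_top"
      by (rule eventually_mono[OF eventually_ge_at_top[of 1]])
         (use mult_left_mono[of 1 _ "\<bar>c\<bar>"] in auto)
  qed
  ultimately show "(\<lambda>t. LINT x:{0..}|lborel. norm (u x t)) \<in> O[at_top](\<lambda>t::real. t)"
    by simp
qed

text \<open>With \<open>r = e^(s x)\<close>, expand the fraction for \<open>U\<close> first by
  \<open>r^2\<close> and then by \<open>S + s\<close>, undoing the normalisation of
  \<open>den\<close>.\<close>

lemma u_explicit:
  assumes "x \<ge> 0"
  shows "u x t = explicit_solution \<alpha> \<omega> x t"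
proof -
  define r where "r = exp (x * s)"
  have r: "r > 0"
    by (simp add: r_def)
  have r2: "exp (2 * x * s) = r\<^sup>2" and r3: "exp (- (2 * s * x)) = inverse (r\<^sup>2)" and r4: "exp (- (s * x)) = inverse r"
    by (simp_all add: r_def exp_minus power2_eq_square mult_ac flip: exp_add)
  have "den x > 0"
    using den_pos assms by simp
  moreover have den_r: "den x * r\<^sup>2 = (S + s) * r\<^sup>2 - (S - s)"
  proof -
    have "exp (- (2 * s * x)) * r\<^sup>2 = 1"
      unfolding r3 using r by simp
    moreover have "den x * r\<^sup>2 = (S + s) * r\<^sup>2 - (S - s) * (exp (- (2 * s * x)) * r\<^sup>2)"
      by (simp add: den_def algebra_simps)
    ultimately show ?thesis
      by simp
  qed
  ultimately have d: "(S + s) * r\<^sup>2 - (S - s) > 0"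
    using r by (metis mult_pos_pos zero_less_power)
  have "U x = 2 * \<alpha> * s * inverse r * r\<^sup>2 / (den x * r\<^sup>2)"
    using r by (simp add: U_def r4)
  then have U: "U x = 2 * \<alpha> * s * r / ((S + s) * r\<^sup>2 - (S - s))"
    using r unfolding den_r by (simp add: power2_eq_square)
  have "\<alpha>\<^sup>2 * (r\<^sup>2 - 1) + 2 * s * (S + s) * r\<^sup>2 = (S\<^sup>2 - s\<^sup>2) * (r\<^sup>2 - 1) + 2 * s * (S + s) * r\<^sup>2"
    by (simp add: S_sq s_sq)
  also have "\<dots> = (S + s) * ((S + s) * r\<^sup>2 - (S - s))"
    by algebra
  finally have den: "\<alpha>\<^sup>2 * (r\<^sup>2 - 1) + 2 * s * (S + s) * r\<^sup>2 = (S + s) * ((S + s) * r\<^sup>2 - (S - s))" .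
  have "U x = 2 * \<alpha> * s * (S + s) * r / (\<alpha>\<^sup>2 * (r\<^sup>2 - 1) + 2 * s * (S + s) * r\<^sup>2)"
  proof -
    have "b * k * r / (k * D) = b * r / D" if "k \<noteq> 0" for b k D :: real
      using that by (cases "D = 0") (simp_all add: field_simps)
    then show ?thesis
      unfolding den U using S_gt s_pos by simp
  qed
  then show ?thesis
    unfolding u_def explicit_solution_def s_def[symmetric] S_def[symmetric] r2 exp_add
      r_def[symmetric] exp_of_real
    by (simp add: mult_ac)
qed

end

section \<open>Uniqueness in the quarter plane and the equivalence\<close>

text \<open>For \<open>s > 0\<close> use the strip starting at \<open>s / 2\<close>, which is
  positive and strictly before \<open>s\<close>; the initial time is reached by continuity.\<close>

lemma nls_quarter_solution_unique:
  assumes "nls_quarter_solution u" "nls_quarter_solution v"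
    and data: "\<And>t. t \<ge> 0 \<Longrightarrow> v 0 t = u 0 t" "\<And>t. t \<ge> 0 \<Longrightarrow> pdx v 0 t = pdx u 0 t"
    and "x \<ge> 0" "t \<ge> 0"
  shows "v x t = u x t"
proof -
  have pos: "v x s - u x s = 0" if "s \<in> {0<..}" for s
    using nls_cauchy_unique[OF nls_quarter_solution_strip[OF assms(1), of "s / 2"]
        nls_quarter_solution_strip[OF assms(2), of "s / 2"] data \<open>x \<ge> 0\<close>, of s] that
    by simp
  have slice: "continuous_on {0..} (\<lambda>s. f x s)" if "nls_quarter_solution f" for f
  proof -
    have "continuous_on ({0..} \<times> {0..}) (\<lambda>(x, t). f x t)"
      using that by (simp add: nls_quarter_solution_def smooth_quarter_continuous)
    then have "continuous_on {0..} (\<lambda>s. (\<lambda>(x, t). f x t) (x, s))"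
      by (rule continuous_on_compose2) (use \<open>x \<ge> 0\<close> in \<open>auto intro!: continuous_intros\<close>)
    then show ?thesis by simp
  qed
  have "continuous_on (closure {0<..}) (\<lambda>s. v x s - u x s)"
    using slice[OF assms(1)] slice[OF assms(2)] by (auto intro!: continuous_intros)
  from continuous_constant_on_closure[OF this pos, of t] show ?thesis
    using \<open>t \<ge> 0\<close> by simp
qed

theorem theorem2:
  fixes \<alpha> \<omega> :: real and c :: complex
  assumes "\<alpha> > 0"
  shows "(eventually_admissible (\<lambda>t. of_real \<alpha> * exp (\<i> * of_real (\<omega> * t)))
                                (\<lambda>t. c * exp (\<i> * of_real (\<omega> * t)))
            \<longleftrightarrow> (\<alpha>, \<omega>, c) \<in> admissible_triples) \<and>
         ((\<alpha>, \<omega>, c) \<in> admissible_triples \<longrightarrow>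
            (\<exists>u. nls_quarter_solution u \<and>
                 (\<forall>t\<ge>0. u 0 t = of_real \<alpha> * exp (\<i> * of_real (\<omega> * t)) \<and>
                        pdx u 0 t = c * exp (\<i> * of_real (\<omega> * t))) \<and>
                 (\<forall>v. nls_quarter_solution v \<and>
                      (\<forall>t\<ge>0. v 0 t = of_real \<alpha> * exp (\<i> * of_real (\<omega> * t)) \<and>
                             pdx v 0 t = c * exp (\<i> * of_real (\<omega> * t)))
                      \<longrightarrow> (\<forall>x\<ge>0. \<forall>t\<ge>0. v x t = u x t)) \<and>
                 (\<forall>x\<ge>0. \<forall>t\<ge>0. u x t = explicit_solution \<alpha> \<omega> x t)))"
proof -
  let ?g0 = "\<lambda>t. of_real \<alpha> * exp (\<i> * of_real (\<omega> * t))"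
  let ?g1 = "\<lambda>t. c * exp (\<i> * of_real (\<omega> * t))"
  have necessary: "(\<alpha>, \<omega>, c) \<in> admissible_triples" if "eventually_admissible ?g0 ?g1"
    using that eventually_admissible_necessary[OF _ _ assms] unfolding eventually_admissible_def by blast
  have solution: "\<exists>u. nls_quarter_solution u \<and> (\<forall>t\<ge>0. u 0 t = ?g0 t \<and> pdx u 0 t = ?g1 t)
      \<and> (\<forall>x\<ge>0. \<forall>t\<ge>0. u x t = explicit_solution \<alpha> \<omega> x t)"
    if "(\<alpha>, \<omega>, c) \<in> admissible_triples"
  proof -
    have \<omega>: "\<omega> > 0" and c: "c = of_real (- \<alpha> * sqrt (\<omega> + \<alpha>\<^sup>2))"
      using that by (auto simp: admissible_triples_def)
    interpret soliton \<alpha> \<omega>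
      using assms \<omega> by unfold_locales
    \<comment> \<open>The slope at the boundary is \<open>- U 0 * W 0 = - \<alpha> S\<close>, which
      is the prescribed value of \<open>c\<close>.\<close>
    have "u 0 t = ?g0 t" "pdx u 0 t = ?g1 t" for t
      using pdx_u[of 0 t] by (simp_all add: u_def U_0 W_0 S_def c add.commute)
    then show ?thesis
      using u_solution u_explicit by blast
  qed
  have "eventually_admissible ?g0 ?g1" if adm: "(\<alpha>, \<omega>, c) \<in> admissible_triples"
  proof -
    obtain u where u: "nls_quarter_solution u" "\<forall>t\<ge>0. u 0 t = ?g0 t \<and> pdx u 0 t = ?g1 t"
      using solution[OF adm] by blast
    show ?thesis
      unfolding eventually_admissible_def
      by (intro conjI smooth_half_phase exI[of _ u] exI[of _ 1]) (use u in auto)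
  qed
  moreover have "\<exists>u. nls_quarter_solution u \<and> (\<forall>t\<ge>0. u 0 t = ?g0 t \<and> pdx u 0 t = ?g1 t) \<and>
      (\<forall>v. nls_quarter_solution v \<and> (\<forall>t\<ge>0. v 0 t = ?g0 t \<and> pdx v 0 t = ?g1 t)
        \<longrightarrow> (\<forall>x\<ge>0. \<forall>t\<ge>0. v x t = u x t)) \<and>
      (\<forall>x\<ge>0. \<forall>t\<ge>0. u x t = explicit_solution \<alpha> \<omega> x t)"
    if adm: "(\<alpha>, \<omega>, c) \<in> admissible_triples"
  proof -
    obtain u where u: "nls_quarter_solution u" "\<forall>t\<ge>0. u 0 t = ?g0 t \<and> pdx u 0 t = ?g1 t"
      "\<forall>x\<ge>0. \<forall>t\<ge>0. u x t = explicit_solution \<alpha> \<omega> x t"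
      using solution[OF adm] by blast
    moreover have "v x t = u x t"
      if "nls_quarter_solution v" "\<forall>t\<ge>0. v 0 t = ?g0 t \<and> pdx v 0 t = ?g1 t" "x \<ge> 0" "t \<ge> 0" for v x t
      using nls_quarter_solution_unique[OF u(1) that(1) _ _ that(3,4)] that(2) u(2) by simp
    ultimately show ?thesis
      by blast
  qed
  ultimately show ?thesis
    using necessary by blast
qed

end
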